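(* Let $\Gamma$ be a simple graph of order $n>0$ with vertex set $V$ and $c$ connected components, let $\mathfrak{G}$ be a finite group of order $\gamma>0$, let $X\subseteq V$ be any set, and let $\zeta$ be the number of isolated vertices of $\Gamma$ that are not in $X$. Then for each $i=0,1,\dots,n-\zeta$, the signless Whitney number $\bar w_i(\mathfrak{G}\cdot\Gamma^{(X)})$ is a polynomial function of $\gamma$ of degree $\min(i,n-c)$; specifically, $$\bar w_i(\mathfrak{G}\cdot\Gamma^{(X)})=\sum_{j=0}^{i}\gamma^j\sum_{k=0}^{i-j}(-1)^k\binom{n-j-k}{n-i}\sum_{\substack{Y\subseteq V\setminus X\ \text{stable}\\ |Y|=k}}\bar w_j(\Gamma\setminus Y)$$ for $i\le n-\zeta$, while $\bar w_i(\mathfrak{G}\cdot\Gamma^{(X)})=0$ for $i>n-\zeta$. The leading term is $\bar w_i(\Gamma)\gamma^i$ if $i\le n-c$, and is $\bar w_{n-c}(\Gamma)\binom{c-\zeta}{i-(n-c)}\gamma^{n-c}$ if $n-c\le i\le n-\zeta$.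
   Context: A gain graph $\Phi$ over a group $\mathfrak{G}$ consists of a graph (possibly with half edges, i.e. edges with only one endpoint) on vertex set $V$, $|V|=n$, together with a map $\phi$ assigning to each oriented (ordinary) edge an element of $\mathfrak{G}$ such that reversing the orientation inverts the gain. The gain of a circle $C=e_1e_2\cdots e_l$ (traversed in a direction) is $\phi(e_1)\cdots\phi(e_l)$; $C$ is neutral if this is the identity. An edge set is balanced if it contains no half edges and every circle in it is neutral. For $S\subseteq E(\Phi)$, $b(S)$ denotes the number of connected components of the spanning subgraph $(V,S)$ whose edge sets are balanced. The chromatic polynomial is $\chi_\Phi(\lambda)=\sum_{S\subseteq E(\Phi)}(-1)^{|S|}\lambda^{b(S)}$, the signless chromatic polynomial is $\bar\chi_\Phi(\lambda)=(-1)^n\chi_\Phi(-\lambda)$, and the signless Whitney numbers $\bar w_i(\Phi)$ are defined by $\bar\chi_\Phi(\lambda)=\sum_{i=0}^{n}\bar w_i(\Phi)\lambda^{n-i}$. For an ordinary graph $\Delta$ of order $m$, $\bar w_j(\Delta)$ is defined from its usual chromatic polynomial by $(-1)^m\chi_\Delta(-\lambda)=\sum_j\bar w_j(\Delta)\lambda^{m-j}$. The $\mathfrak{G}$-expansion $\mathfrak{G}\cdot\Gamma$ of a graph $\Gamma=(V,E)$ is the gain graph on $V$ having, for each edge $e\in E$ (with a fixed orientation) and each $g\in\mathfrak{G}$, an edge $ge$ with the same endpoints and gain $g$ in that orientation. For $X\subseteq V$, $\mathfrak{G}\cdot\Gamma^{(X)}$ is $\mathfrak{G}\cdot\Gamma$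 with one half edge added at each vertex of $X$. A vertex set is stable if no edge of $\Gamma$ has both endpoints in it (the empty set is stable). $\Gamma\setminus Y$ denotes the graph obtained by deleting the vertices in $Y$ and their incident edges. *)

theory Defs
  imports "HOL-Algebra.Coset" "HOL-Computational_Algebra.Polynomial"
begin

section \<open>Polynomials and signless Whitney numbers\<close>

definition signless_poly :: "nat \<Rightarrow> int poly \<Rightarrow> int poly" where
  "signless_poly m p = smult ((- 1) ^ m) (p \<circ>\<^sub>p [:0, - 1:])"

definition signless_whitney :: "nat \<Rightarrow> int poly \<Rightarrow> nat \<Rightarrow> int" where
  "signless_whitney m p i = (if i \<le> m then coeff (signless_poly m p) (m - i) else 0)"

section \<open>Simple graphs\<close>

definition simple_graph :: "'v set \<Rightarrow> 'v set set \<Rightarrow> bool" where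
  "simple_graph V E \<longleftrightarrow> finite V \<and> (\<forall>e\<in>E. e \<subseteq> V \<and> card e = 2)"

definition components :: "'v set \<Rightarrow> ('v \<times> 'v) set \<Rightarrow> 'v set set" where
  "components V R = V // {(u, v) \<in> V \<times> V. (u, v) \<in> (R \<union> R\<inverse>)\<^sup>*}"

definition graph_components :: "'v set \<Rightarrow> 'v set set \<Rightarrow> 'v set set" where
  "graph_components V E = components V {(u, v). {u, v} \<in> E}"

definition isolated_vertices :: "'v set \<Rightarrow> 'v set set \<Rightarrow> 'v set" where
  "isolated_vertices V E = {v \<in> V. \<forall>e\<in>E. v \<notin> e}"

definition stable :: "'v set set \<Rightarrow> 'v set \<Rightarrow> bool" where
  "stable E Y \<longleftrightarrow> (\<forall>e\<in>E. \<not> e \<subseteq> Y)"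

definition delete_edges_at :: "'v set set \<Rightarrow> 'v set \<Rightarrow> 'v set set" where
  "delete_edges_at E Y = {e \<in> E. e \<inter> Y = {}}"

definition proper_colorings :: "'v set \<Rightarrow> 'v set set \<Rightarrow> nat \<Rightarrow> ('v \<Rightarrow> nat) set" where
  "proper_colorings V E k =
     {f \<in> V \<rightarrow>\<^sub>E {..<k}. \<forall>u v. {u, v} \<in> E \<longrightarrow> f u \<noteq> f v}"

definition chromatic_poly :: "'v set \<Rightarrow> 'v set set \<Rightarrow> int poly" where
  "chromatic_poly V E =
     (THE p. \<forall>k. poly p (int k) = int (card (proper_colorings V E k)))"

definition graph_whitney :: "'v set \<Rightarrow> 'v set set \<Rightarrow> nat \<Rightarrow> int" where
  "graph_whitney V E = signless_whitney (card V) (chromatic_poly V E)"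

section \<open>Gain graphs with half edges\<close>

text \<open>Each ordinary edge \<open>e\<close> carries a reference orientation from \<open>src e\<close> to \<open>dst e\<close>, in which its
  gain is \<open>gain e\<close>; the gain of the reverse orientation is the inverse. The only endpoint of a half
  edge \<open>e\<close> is \<open>src e\<close>; its \<open>dst\<close> and \<open>gain\<close> are never consulted.\<close>

record ('v, 'e, 'g) gain_graph =
  vertices :: "'v set"
  ordinary :: "'e set"
  half :: "'e set"
  src :: "'e \<Rightarrow> 'v"
  dst :: "'e \<Rightarrow> 'v"
  gain :: "'e \<Rightarrow> 'g"

definition wf_gain_graph :: "('g, 'b) monoid_scheme \<Rightarrow> ('v, 'e, 'g) gain_graph \<Rightarrow> bool" where
  "wf_gain_graph G \<Phi> \<longleftrightarrow> finite (vertices \<Phi>) \<and> finite (ordinary \<Phi>) \<and> finite (half \<Phi>) \<and>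
     ordinary \<Phi> \<inter> half \<Phi> = {} \<and>
     (\<forall>e\<in>ordinary \<Phi>. src \<Phi> e \<in> vertices \<Phi> \<and> dst \<Phi> e \<in> vertices \<Phi> \<and> gain \<Phi> e \<in> carrier G) \<and>
     (\<forall>e\<in>half \<Phi>. src \<Phi> e \<in> vertices \<Phi>)"

definition edges :: "('v, 'e, 'g) gain_graph \<Rightarrow> 'e set" where
  "edges \<Phi> = ordinary \<Phi> \<union> half \<Phi>"

text \<open>An oriented edge is a pair \<open>(e, d)\<close>, with \<open>d = True\<close> for the reference orientation.\<close>

fun from_vertex :: "('v, 'e, 'g) gain_graph \<Rightarrow> 'e \<times> bool \<Rightarrow> 'v" where
  "from_vertex \<Phi> (e, d) = (if d then src \<Phi> e else dst \<Phi> e)"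

fun to_vertex :: "('v, 'e, 'g) gain_graph \<Rightarrow> 'e \<times> bool \<Rightarrow> 'v" where
  "to_vertex \<Phi> (e, d) = (if d then dst \<Phi> e else src \<Phi> e)"

fun oriented_gain ::
  "('g, 'b) monoid_scheme \<Rightarrow> ('v, 'e, 'g) gain_graph \<Rightarrow> 'e \<times> bool \<Rightarrow> 'g" where
  "oriented_gain G \<Phi> (e, d) = (if d then gain \<Phi> e else inv\<^bsub>G\<^esub> gain \<Phi> e)"

text \<open>A circle, given by a starting point and a direction of traversal. Loops (length 1) and pairs of
  parallel edges (length 2) are circles; distinctness of the edges excludes going back and forth
  along a single edge.\<close>

definition circle_in :: "('v, 'e, 'g) gain_graph \<Rightarrow> 'e set \<Rightarrow> ('e \<times> bool) list \<Rightarrow> bool" where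
  "circle_in \<Phi> S C \<longleftrightarrow> C \<noteq> [] \<and> fst ` set C \<subseteq> S \<inter> ordinary \<Phi> \<and>
     distinct (map fst C) \<and> distinct (map (from_vertex \<Phi>) C) \<and>
     (\<forall>i<length C. to_vertex \<Phi> (C ! i) = from_vertex \<Phi> (C ! (Suc i mod length C)))"

definition circle_gain ::
  "('g, 'b) monoid_scheme \<Rightarrow> ('v, 'e, 'g) gain_graph \<Rightarrow> ('e \<times> bool) list \<Rightarrow> 'g" where
  "circle_gain G \<Phi> C = foldr (\<otimes>\<^bsub>G\<^esub>) (map (oriented_gain G \<Phi>) C) \<one>\<^bsub>G\<^esub>"

definition balanced :: "('g, 'b) monoid_scheme \<Rightarrow> ('v, 'e, 'g) gain_graph \<Rightarrow> 'e set \<Rightarrow> bool" where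
  "balanced G \<Phi> S \<longleftrightarrow> S \<inter> half \<Phi> = {} \<and> (\<forall>C. circle_in \<Phi> S C \<longrightarrow> circle_gain G \<Phi> C = \<one>\<^bsub>G\<^esub>)"

definition spanning_components :: "('v, 'e, 'g) gain_graph \<Rightarrow> 'e set \<Rightarrow> 'v set set" where
  "spanning_components \<Phi> S =
     components (vertices \<Phi>) ((\<lambda>e. (src \<Phi> e, dst \<Phi> e)) ` (S \<inter> ordinary \<Phi>))"

text \<open>Both ends of an ordinary edge of \<open>S\<close> lie in the same component of the spanning subgraph, so
  \<open>src\<close> alone tells which component contains a given edge of \<open>S\<close>.\<close>

definition num_balanced :: "('g, 'b) monoid_scheme \<Rightarrow> ('v, 'e, 'g) gain_graph \<Rightarrow> 'e set \<Rightarrow> nat" where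
  "num_balanced G \<Phi> S =
     card {W \<in> spanning_components \<Phi> S. balanced G \<Phi> {e \<in> S. src \<Phi> e \<in> W}}"

definition gain_chromatic_poly ::
  "('g, 'b) monoid_scheme \<Rightarrow> ('v, 'e, 'g) gain_graph \<Rightarrow> int poly" where
  "gain_chromatic_poly G \<Phi> =
     (\<Sum>S\<in>Pow (edges \<Phi>). monom ((- 1) ^ card S) (num_balanced G \<Phi> S))"

definition gain_whitney ::
  "('g, 'b) monoid_scheme \<Rightarrow> ('v, 'e, 'g) gain_graph \<Rightarrow> nat \<Rightarrow> int" where
  "gain_whitney G \<Phi> = signless_whitney (card (vertices \<Phi>)) (gain_chromatic_poly G \<Phi>)"

section \<open>Group expansions\<close>

definition orientation :: "'v set set \<Rightarrow> ('v set \<Rightarrow> 'v \<times> 'v) \<Rightarrow> bool" where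
  "orientation E ori \<longleftrightarrow> (\<forall>e\<in>E. e = {fst (ori e), snd (ori e)})"

datatype ('v, 'g) expansion_edge = Lift 'g "'v set" | Half 'v

definition expansion ::
  "('g, 'b) monoid_scheme \<Rightarrow> 'v set \<Rightarrow> 'v set set \<Rightarrow> ('v set \<Rightarrow> 'v \<times> 'v) \<Rightarrow> 'v set \<Rightarrow>
     ('v, ('v, 'g) expansion_edge, 'g) gain_graph" where
  "expansion G V E ori X =
     \<lparr>vertices = V,
      ordinary = {Lift g e | g e. g \<in> carrier G \<and> e \<in> E},
      half = Half ` X,
      src = (\<lambda>a. case a of Lift g e \<Rightarrow> fst (ori e) | Half x \<Rightarrow> x),
      dst = (\<lambda>a. case a of Lift g e \<Rightarrow> snd (ori e) | Half x \<Rightarrow> x),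
      gain = (\<lambda>a. case a of Lift g e \<Rightarrow> g | Half x \<Rightarrow> \<one>\<^bsub>G\<^esub>)\<rparr>"

lemma wf_expansion:
  assumes "simple_graph V E" "orientation E ori" "finite (carrier G)" "X \<subseteq> V"
  shows "wf_gain_graph G (expansion G V E ori X)"
proof -
  have V: "finite V" and EV: "\<And>e. e \<in> E \<Longrightarrow> e \<subseteq> V"
    using assms(1) by (auto simp: simple_graph_def)
  have "finite E"
    using V EV by (meson Pow_iff finite_Pow_iff finite_subset subsetI)
  moreover have "{Lift g e | g e. g \<in> carrier G \<and> e \<in> E} =
      (\<lambda>(g, e). Lift g e) ` (carrier G \<times> E)"
    by auto
  moreover have "fst (ori e) \<in> V" "snd (ori e) \<in> V" if "e \<in> E" for e
    using assms(2) EV[OF that] that unfolding orientation_def by blast+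
  ultimately show ?thesis
    using V assms(3,4) finite_subset[OF assms(4) V]
    by (auto simp: wf_gain_graph_def expansion_def)
qed

text \<open>The candidate polynomial for the Whitney numbers of an expansion, in an indeterminate standing
  for the group order. It depends on the graph and on \<open>X\<close> only, not on the group.\<close>

definition expansion_whitney_poly :: "'v set \<Rightarrow> 'v set set \<Rightarrow> 'v set \<Rightarrow> nat \<Rightarrow> int poly" where
  "expansion_whitney_poly V E X i =
     (\<Sum>j=0..i. monom
        (\<Sum>k=0..i - j. (- 1) ^ k * int ((card V - j - k) choose (card V - i)) *
          (\<Sum>Y | Y \<subseteq> V - X \<and> stable E Y \<and> card Y = k.
             graph_whitney (V - Y) (delete_edges_at E Y) j)) j)"

end

theory Submission
  imports Defs
begin

text \<open>Let \<open>\<gamma>\<close> be the group order and colour the vertices with \<open>\<gamma> k + 1\<close> colours: a zero colour and \<open>k\<close>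
  copies of the group. The assignments that violate every edge of \<open>S\<close> are free to choose one colour
  per balanced component of \<open>S\<close> and must vanish on the others, so by inclusion-exclusion the
  chromatic polynomial at \<open>\<gamma> k + 1\<close> counts the proper gain colourings. Sorting these by the
  (stable) set \<open>Y\<close> of vertices of colour zero gives
  \<open>\<chi>(\<lambda>) = (\<Sum>Y. \<gamma> ^ (n - |Y|) * \<chi>\<^bsub>\<Gamma>-Y\<^esub>((\<lambda> - 1) / \<gamma>))\<close>, and comparing coefficients gives the
  formula. Its top coefficient in \<open>\<gamma>\<close> is controlled by deletion-contraction, which shows that the
  Whitney numbers of a graph are positive up to its rank and vanish beyond.\<close>

section \<open>Components of a relation\<close>

text \<open>The two kinds of chromatic polynomial are defined differently, one as a sum over edge
  sets and one by its values, so they are compared at infinitely many integers. A colour fixed by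
  the whole group is indispensable: an unbalanced component must admit exactly one assignment, to
  match the missing factor \<open>\<lambda>\<close>. This is where the \<open>+ 1\<close> in
  \<open>\<gamma> k + 1\<close> comes from. The work in the count lies in passing from a condition
  on circles to a potential on vertices; closed walks mediate, because they can be cut and joined.
  Component numbers are never handled directly in the rank arguments. They are read off from the
  number \<open>2 ^ c\<close> of two-valued maps constant along edges, so that colourings and
  components share one contraction bijection. The coefficients of the formula are alternating sums,
  so their signs are not visible. At the top power of \<open>\<gamma>\<close> almost all terms
  vanish for reasons of rank, and the rest can be summed in closed form. The vanishing for
  \<open>i > n - \<zeta>\<close> comes straight from the sum over edge sets.\<close>

abbreviation component_rel :: "'v set \<Rightarrow> ('v \<times> 'v) set \<Rightarrow> ('v \<times> 'v) set" where
  "component_rel V R \<equiv> {(u, v) \<in> V \<times> V. (u, v) \<in> (R \<union> R\<inverse>)\<^sup>*}"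

lemma equiv_component_rel: "equiv V (component_rel V R)"
proof (rule equivI)
  show "sym (component_rel V R)"
    using sym_rtrancl[OF sym_Un_converse[of R]] by (auto simp: sym_def)
qed (auto simp: refl_on_def trans_def)

lemma component_rel_sym: "(u, v) \<in> component_rel V R \<Longrightarrow> (v, u) \<in> component_rel V R"
  using equiv_component_rel[of V R] by (rule equivE) (rule symD)

lemma component_unique:
  assumes "W \<in> components V R" "v \<in> W"
  shows "W = component_rel V R `` {v}"
proof -
  obtain x where x: "x \<in> V" "W = component_rel V R `` {x}"
    using assms(1) by (auto simp: components_def elim!: quotientE)
  then have "(x, v) \<in> component_rel V R"
    using assms(2) by blast
  then show ?thesis
    unfolding x(2) by (rule equiv_class_eq[OF equiv_component_rel])
qed

lemma component_subset: "W \<in> components V R \<Longrightarrow> W \<subseteq> V"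
  by (auto simp: components_def elim!: quotientE)

lemma component_nonempty: "W \<in> components V R \<Longrightarrow> W \<noteq> {}"
  unfolding components_def using in_quotient_imp_non_empty[OF equiv_component_rel] by blast

lemma component_of:
  assumes "v \<in> V"
  shows "component_rel V R `` {v} \<in> components V R" "v \<in> component_rel V R `` {v}"
  using assms unfolding components_def by (rule quotientI) (use assms in auto)

lemma Union_components: "\<Union> (components V R) = V"
  unfolding components_def by (rule Union_quotient[OF equiv_component_rel])

lemma component_edge_closed:
  assumes "W \<in> components V R" "(u, v) \<in> R" "R \<subseteq> V \<times> V"
  shows "u \<in> W \<longleftrightarrow> v \<in> W"
proof -
  have uv: "(u, v) \<in> component_rel V R"
    using assms by auto
  then have eq: "component_rel V R `` {u} = component_rel V R `` {v}"
    by (rule equiv_class_eq[OF equiv_component_rel])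
  have "u \<in> V" "v \<in> V"
    using uv by auto
  then have "u \<in> component_rel V R `` {v}" "v \<in> component_rel V R `` {u}"
    using component_of(2)[of u V R] component_of(2)[of v V R] unfolding eq by blast+
  then show ?thesis
    using component_unique[OF assms(1), of u] component_unique[OF assms(1), of v] by blast
qed

lemma constant_on_component:
  assumes "\<And>u v. (u, v) \<in> R \<Longrightarrow> f u = f v"
    and "W \<in> components V R" "u \<in> W" "v \<in> W"
  shows "f u = f v"
proof -
  have "(u, v) \<in> (R \<union> R\<inverse>)\<^sup>*"
    using component_unique[OF assms(2,3)] assms(4) by simp
  then show ?thesis
  proof (induction rule: rtrancl_induct)
    case (step y z)
    then show ?case
      using assms(1)[of y z] assms(1)[of z y] by auto
  qed simp
qed

lemma finite_components: "finite V \<Longrightarrow> finite (components V R)"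
  using component_subset by (metis PowI finite_Pow_iff finite_subset subsetI)

text \<open>Such a map has one free value for each component in \<open>B\<close> and is pinned to
  \<open>z\<close> elsewhere. It is applied with \<open>B\<close> the balanced components, and with
  \<open>B\<close> all components, where the condition on \<open>z\<close> is vacuous.\<close>

lemma card_constant_on_components:
  assumes "finite V" "z \<in> C" and R: "R \<subseteq> V \<times> V" and B: "B \<subseteq> components V R"
  shows "card {f \<in> V \<rightarrow>\<^sub>E C. (\<forall>(u, v)\<in>R. f u = f v) \<and> (\<forall>v\<in>V - \<Union>B. f v = z)} = card C ^ card B"
    (is "card ?F = _")
proof -
  define K where "K = (\<lambda>v. component_rel V R `` {v})"
  \<comment> \<open>Any representative of \<open>W\<close> would do, since \<open>f\<close> is
    constant on components.\<close>
  let ?to = "\<lambda>f. \<lambda>W\<in>B. f (SOME v. v \<in> W)"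
  let ?from = "\<lambda>h. \<lambda>v\<in>V. if K v \<in> B then h (K v) else z"
  have K: "K v \<in> components V R" "v \<in> K v" if "v \<in> V" for v
    unfolding K_def by (rule component_of[OF that])+
  have K_eq: "K v = W" if "W \<in> B" "v \<in> W" for v W
    unfolding K_def by (rule component_unique[symmetric]) (use that B in auto)
  have finB: "finite B"
    using B finite_components[OF assms(1)] finite_subset by blast
  have some: "(SOME v. v \<in> W) \<in> W" if "W \<in> B" for W
    using component_nonempty[of W V R] B that by (auto simp: some_in_eq)
  have inB: "K v \<in> B \<longleftrightarrow> v \<in> \<Union>B" if "v \<in> V" for v
    using K_eq K[OF that] by blast
  have "bij_betw ?to ?F (B \<rightarrow>\<^sub>E C)"
  proof (rule bij_betw_byWitness[where f' = ?from])
    show "\<forall>f\<in>?F. ?from (?to f) = f"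
    proof
      fix f assume f: "f \<in> ?F"
      show "?from (?to f) = f"
      proof
        fix v
        show "?from (?to f) v = f v"
        proof (cases "v \<in> V \<and> K v \<in> B")
          case True
          then have "K v \<in> components V R" "(SOME u. u \<in> K v) \<in> K v" "v \<in> K v"
            using K[of v] some[of "K v"] by simp_all
          moreover have "f u = f w" if "(u, w) \<in> R" for u w
            using f that by blast
          ultimately have "f (SOME u. u \<in> K v) = f v"
            by (rule constant_on_component[rotated])
          then show ?thesis
            using True by simp
        next
          case False
          then show ?thesis
            using f inB[of v] by (cases "v \<in> V") (auto intro: PiE_arb)
        qed
      qed
    qed
    show "\<forall>h\<in>B \<rightarrow>\<^sub>E C. ?to (?from h) = h"
    proof
      fix h assume h: "h \<in> B \<rightarrow>\<^sub>E C"
      show "?to (?from h) = h"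
      proof
        fix W
        show "?to (?from h) W = h W"
        proof (cases "W \<in> B")
          case True
          then have "(SOME v. v \<in> W) \<in> V" "K (SOME v. v \<in> W) = W"
            using some[OF True] B True component_subset[of W V R] by (blast, intro K_eq)
          then show ?thesis
            using True by simp
        next
          case False
          then show ?thesis
            using PiE_arb[OF h False] by simp
        qed
      qed
    qed
    show "?to ` ?F \<subseteq> B \<rightarrow>\<^sub>E C"
    proof (intro image_subsetI PiE_I)
      fix f W assume "f \<in> ?F" "W \<in> B"
      then show "?to f W \<in> C"
        using some[of W] B component_subset[of W V R] by (force intro: PiE_mem)
    qed auto
    show "?from ` (B \<rightarrow>\<^sub>E C) \<subseteq> ?F"
    proof (rule image_subsetI)
      fix h assume h: "h \<in> B \<rightarrow>\<^sub>E C"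
      have "K u = K v" if "(u, v) \<in> R" for u v
        unfolding K_def by (rule equiv_class_eq[OF equiv_component_rel]) (use that R in auto)
      then have "?from h u = ?from h v" if "(u, v) \<in> R" for u v
        using R that by (simp add: subset_iff)
      moreover have "?from h \<in> V \<rightarrow>\<^sub>E C"
        using h assms(2) by (auto intro: PiE_mem)
      moreover have "\<forall>v\<in>V - \<Union>B. ?from h v = z"
        using inB by auto
      ultimately show "?from h \<in> ?F"
        by blast
    qed
  qed
  then have "card ?F = card (B \<rightarrow>\<^sub>E C)"
    by (rule bij_betw_same_card)
  then show ?thesis
    by (simp add: card_PiE[OF finB])
qed

section \<open>Walks and potentials\<close>

text \<open>Circles cannot be cut or joined, as the inductions below require; walks can. Carrying
  both end vertices gives even the empty walk a position.\<close>

inductive walk :: "('v, 'e, 'g) gain_graph \<Rightarrow> 'e set \<Rightarrow> 'v \<Rightarrow> ('e \<times> bool) list \<Rightarrow> 'v \<Rightarrow> bool"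
  for \<Phi> S where
  walk_Nil: "walk \<Phi> S u [] u"
| walk_Cons: "\<lbrakk>fst x \<in> S \<inter> ordinary \<Phi>; walk \<Phi> S (to_vertex \<Phi> x) C v\<rbrakk> \<Longrightarrow>
    walk \<Phi> S (from_vertex \<Phi> x) (x # C) v"

inductive_simps walk_Nil_iff: "walk \<Phi> S u [] v"

lemma walk_Cons_iff:
  "walk \<Phi> S u (x # C) v \<longleftrightarrow>
    u = from_vertex \<Phi> x \<and> fst x \<in> S \<inter> ordinary \<Phi> \<and> walk \<Phi> S (to_vertex \<Phi> x) C v"
  by (auto elim: walk.cases intro: walk.intros)

text \<open>Serves for a repeated vertex (\<open>f = from_vertex \<Phi>\<close>) and for a repeated
  edge (\<open>f = fst\<close>).\<close>

lemma not_distinct_map_decomp: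
  assumes "\<not> distinct (map f C)"
  obtains A a B b D where "C = A @ a # B @ b # D" "f a = f b"
proof -
  obtain i j where ij: "i < j" "j < length C" "f (C ! i) = f (C ! j)"
    using assms by (auto simp: distinct_conv_nth) (metis linorder_neqE_nat)
  have "drop (Suc i) C = take (j - Suc i) (drop (Suc i) C) @ C ! j # drop (Suc j) C"
    using ij id_take_nth_drop[of "j - Suc i" "drop (Suc i) C"] by simp
  then have "C = take i C @ C ! i # take (j - Suc i) (drop (Suc i) C) @ C ! j # drop (Suc j) C"
    using ij id_take_nth_drop[of i C] by simp
  then show ?thesis
    using that ij(3) by blast
qed

lemma walk_append_iff: "walk \<Phi> S u (A @ B) v \<longleftrightarrow> (\<exists>w. walk \<Phi> S u A w \<and> walk \<Phi> S w B v)"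
  by (induction A arbitrary: u) (auto simp: walk_Nil_iff walk_Cons_iff)

lemma walk_edges: "walk \<Phi> S u C v \<Longrightarrow> fst ` set C \<subseteq> S \<inter> ordinary \<Phi>"
  by (induction rule: walk.induct) auto

lemma walk_last: "walk \<Phi> S u C v \<Longrightarrow> C \<noteq> [] \<Longrightarrow> to_vertex \<Phi> (last C) = v"
  by (induction rule: walk.induct) (auto simp: walk_Nil_iff)

lemma walk_hd: "walk \<Phi> S u C v \<Longrightarrow> C \<noteq> [] \<Longrightarrow> from_vertex \<Phi> (hd C) = u"
  by (cases C) (auto simp: walk_Cons_iff)

lemma walk_nth:
  "walk \<Phi> S u C v \<Longrightarrow> Suc i < length C \<Longrightarrow> to_vertex \<Phi> (C ! i) = from_vertex \<Phi> (C ! Suc i)"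
proof (induction arbitrary: i rule: walk.induct)
  case (walk_Cons x C v)
  then show ?case
    using walk_hd[OF walk_Cons(2)] by (cases i; cases C) auto
qed simp

lemma walkI_nth:
  assumes "C \<noteq> []" "fst ` set C \<subseteq> S \<inter> ordinary \<Phi>"
    "\<And>i. Suc i < length C \<Longrightarrow> to_vertex \<Phi> (C ! i) = from_vertex \<Phi> (C ! Suc i)"
  shows "walk \<Phi> S (from_vertex \<Phi> (hd C)) C (to_vertex \<Phi> (last C))"
  using assms
proof (induction C)
  case (Cons x C)
  show ?case
  proof (cases "C = []")
    case True
    then show ?thesis
      using Cons.prems by (auto simp: walk_Cons_iff walk_Nil_iff)
  next
    case False
    have "walk \<Phi> S (from_vertex \<Phi> (hd C)) C (to_vertex \<Phi> (last C))"
      using Cons.prems False by (intro Cons.IH) (auto, force)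
    moreover have "from_vertex \<Phi> (hd C) = to_vertex \<Phi> x"
      using Cons.prems(3)[of 0] False by (auto simp: hd_conv_nth)
    ultimately show ?thesis
      using Cons.prems False by (auto simp: walk_Cons_iff)
  qed
qed simp

lemma walk_of_circle:
  assumes "circle_in \<Phi> S C"
  shows "walk \<Phi> S (from_vertex \<Phi> (hd C)) C (from_vertex \<Phi> (hd C))"
proof -
  have C: "C \<noteq> []" and step: "\<And>i. i < length C \<Longrightarrow>
      to_vertex \<Phi> (C ! i) = from_vertex \<Phi> (C ! (Suc i mod length C))"
    using assms by (auto simp: circle_in_def)
  have "walk \<Phi> S (from_vertex \<Phi> (hd C)) C (to_vertex \<Phi> (last C))"
    using assms step by (intro walkI_nth) (auto simp: circle_in_def)
  moreover have "to_vertex \<Phi> (last C) = from_vertex \<Phi> (hd C)"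
    using step[of "length C - 1"] C by (simp add: last_conv_nth hd_conv_nth)
  ultimately show ?thesis
    by simp
qed

lemma circle_of_walk:
  assumes "walk \<Phi> S u C u" "C \<noteq> []" "distinct (map fst C)" "distinct (map (from_vertex \<Phi>) C)"
  shows "circle_in \<Phi> S C"
  unfolding circle_in_def
proof (intro conjI allI impI)
  fix i assume i: "i < length C"
  show "to_vertex \<Phi> (C ! i) = from_vertex \<Phi> (C ! (Suc i mod length C))"
  proof (cases "Suc i < length C")
    case True
    then show ?thesis
      using walk_nth[OF assms(1)] by simp
  next
    case False
    then have "i = length C - 1" "Suc i mod length C = 0"
      using i by (auto simp: not_less) (metis Suc_leI le_antisym mod_self)
    then show ?thesis
      using walk_last[OF assms(1,2)] walk_hd[OF assms(1,2)] assms(2)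
      by (simp add: last_conv_nth hd_conv_nth)
  qed
qed (use assms walk_edges[OF assms(1)] in auto)

abbreviation edge_rel :: "('v, 'e, 'g) gain_graph \<Rightarrow> 'e set \<Rightarrow> ('v \<times> 'v) set" where
  "edge_rel \<Phi> S \<equiv> (\<lambda>e. (src \<Phi> e, dst \<Phi> e)) ` (S \<inter> ordinary \<Phi>)"

locale finite_gain_graph = group G for G :: "('g, 'b) monoid_scheme" (structure) +
  fixes \<Phi> :: "('v, 'e, 'g) gain_graph"
  assumes wf: "wf_gain_graph G \<Phi>"
begin

lemma oriented_gain_closed: "fst x \<in> ordinary \<Phi> \<Longrightarrow> oriented_gain G \<Phi> x \<in> carrier G"
  using wf by (cases x) (auto simp: wf_gain_graph_def)

lemma circle_gain_simps [simp]:
  "circle_gain G \<Phi> [] = \<one>"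
  "circle_gain G \<Phi> (x # C) = oriented_gain G \<Phi> x \<otimes> circle_gain G \<Phi> C"
  by (auto simp: circle_gain_def)

lemma circle_gain_closed: "fst ` set C \<subseteq> ordinary \<Phi> \<Longrightarrow> circle_gain G \<Phi> C \<in> carrier G"
  by (induction C) (auto simp: oriented_gain_closed)

lemma walk_gain_closed: "walk \<Phi> S u C v \<Longrightarrow> circle_gain G \<Phi> C \<in> carrier G"
  using walk_edges[of \<Phi> S u C v] circle_gain_closed[of C] by simp

lemma circle_gain_append:
  "fst ` set A \<subseteq> ordinary \<Phi> \<Longrightarrow> fst ` set B \<subseteq> ordinary \<Phi> \<Longrightarrow>
    circle_gain G \<Phi> (A @ B) = circle_gain G \<Phi> A \<otimes> circle_gain G \<Phi> B"
  by (induction A) (auto simp: circle_gain_closed oriented_gain_closed m_assoc)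

text \<open>Reverse the order and flip every direction bit.\<close>

lemma walk_reverse:
  "walk \<Phi> S u C v \<Longrightarrow> \<exists>D. walk \<Phi> S v D u \<and> circle_gain G \<Phi> D = inv (circle_gain G \<Phi> C)"
proof (induction rule: walk.induct)
  case (walk_Nil u)
  then show ?case
    by (metis walk.walk_Nil circle_gain_simps(1) inv_one)
next
  case (walk_Cons x C v)
  then obtain D where D: "walk \<Phi> S v D (to_vertex \<Phi> x)"
    "circle_gain G \<Phi> D = inv (circle_gain G \<Phi> C)"
    by blast
  obtain e d where x: "x = (e, d)"
    by (cases x)
  have e: "e \<in> S" "e \<in> ordinary \<Phi>" "gain \<Phi> e \<in> carrier G"
    using walk_Cons(1) x wf by (auto simp: wf_gain_graph_def)
  have "walk \<Phi> S v (D @ [(e, \<not> d)]) (from_vertex \<Phi> x)"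
    using D(1) e x by (auto simp: walk_append_iff walk_Cons_iff walk_Nil_iff)
  moreover have "circle_gain G \<Phi> (D @ [(e, \<not> d)]) = inv (circle_gain G \<Phi> (x # C))"
    using e x D walk_edges[OF D(1)] walk_gain_closed[OF walk_Cons(2)]
    by (subst circle_gain_append) (auto simp: inv_mult_group)
  ultimately show ?case
    by blast
qed

text \<open>A closed walk that is not a circle either revisits a vertex, and then splits into two shorter
  closed walks, or goes back and forth along a single edge.\<close>

lemma closed_walk_neutral:
  assumes "balanced G \<Phi> S" "walk \<Phi> S u C u"
  shows "circle_gain G \<Phi> C = \<one>"
  using assms(2)
proof (induction C arbitrary: u rule: length_induct)
  case (1 C)
  note IH = 1(1)[rule_format] and w = 1(2)
  consider "C = []" | "\<not> distinct (map (from_vertex \<Phi>) C)"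
    | "distinct (map (from_vertex \<Phi>) C)" "\<not> distinct (map fst C)"
    | "C \<noteq> []" "distinct (map (from_vertex \<Phi>) C)" "distinct (map fst C)"
    by blast
  then show ?case
  proof cases
    case 1
    then show ?thesis by simp
  next
    case 2
    then obtain A a B b D y where C: "C = A @ (a # B) @ (b # D)"
      and ab: "from_vertex \<Phi> a = y" "from_vertex \<Phi> b = y"
      by (metis append_Cons not_distinct_map_decomp)
    have wA: "walk \<Phi> S u A y" and wB: "walk \<Phi> S y (a # B) y" and wD: "walk \<Phi> S y (b # D) u"
      using w ab unfolding C walk_append_iff by (auto simp: walk_Cons_iff)
    have wAD: "walk \<Phi> S u (A @ b # D) u"
      using wA wD by (auto simp: walk_append_iff)
    have "circle_gain G \<Phi> (a # B) = \<one>" "circle_gain G \<Phi> (A @ b # D) = \<one>"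
      by (rule IH[OF _ wB], simp add: C) (rule IH[OF _ wAD], simp add: C)
    moreover have "fst ` set A \<subseteq> ordinary \<Phi>" "fst ` set (a # B) \<subseteq> ordinary \<Phi>"
        "fst ` set (b # D) \<subseteq> ordinary \<Phi>"
      using walk_edges[OF wA] walk_edges[OF wB] walk_edges[OF wD] by blast+
    ultimately show ?thesis
      unfolding C
      by (simp only: circle_gain_append set_append image_Un Un_subset_iff)
        (simp add: circle_gain_closed oriented_gain_closed)
  next
    case 3
    then obtain A a B b D y where C: "C = A @ a # B @ b # D"
      and ab: "fst a = y" "fst b = y"
      by (metis not_distinct_map_decomp)
    have ne: "from_vertex \<Phi> a \<noteq> from_vertex \<Phi> b"
      using 3(1) unfolding C by auto
    \<comment> \<open>One edge with two different tails is traversed in opposite directions.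
      Distinctness of the tails then leaves no room before, between or after the two traversals, so
      \<open>C = [a, b]\<close>.\<close>
    obtain d where d: "a = (y, d)" "b = (y, \<not> d)"
      using ab ne by (cases a; cases b; cases "snd a"; cases "snd b") auto
    have "walk \<Phi> S (to_vertex \<Phi> a) (B @ b # D) u"
      using w unfolding C walk_append_iff walk_Cons_iff by blast
    moreover have "to_vertex \<Phi> a = from_vertex \<Phi> b"
      using d by simp
    ultimately have B: "B = []"
      using 3(1) unfolding C by (cases B) (auto simp: walk_Cons_iff)
    have "walk \<Phi> S (to_vertex \<Phi> b) D u"
      using w unfolding C walk_append_iff walk_Cons_iff B by auto
    moreover have "to_vertex \<Phi> b = from_vertex \<Phi> a"
      using d by simp
    ultimately have D: "D = []" "u = from_vertex \<Phi> a"
      using 3(1) unfolding C by (cases D; auto simp: walk_Cons_iff walk_Nil_iff)+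
    have A: "A = []"
      using 3(1) w D unfolding C by (cases A) (auto simp: walk_Cons_iff)
    have "gain \<Phi> y \<in> carrier G"
      using walk_edges[OF w] wf d unfolding C by (auto simp: wf_gain_graph_def)
    then show ?thesis
      unfolding C A B D d by (cases d) auto
  next
    case 4
    then show ?thesis
      using circle_of_walk[OF w] assms(1) by (auto simp: balanced_def)
  qed
qed

lemma edge_rel_subset: "edge_rel \<Phi> S \<subseteq> vertices \<Phi> \<times> vertices \<Phi>"
  using wf by (auto simp: wf_gain_graph_def)

lemma src_dst_same_component:
  assumes "W \<in> spanning_components \<Phi> S" "e \<in> S" "e \<in> ordinary \<Phi>"
  shows "src \<Phi> e \<in> W \<longleftrightarrow> dst \<Phi> e \<in> W"
  using assms component_edge_closed[OF _ _ edge_rel_subset]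
  unfolding spanning_components_def by blast

text \<open>Balance is tested on the edges of a single component, so a walk must be known to use no
  others before \<open>closed_walk_neutral\<close> can be applied to it.\<close>

lemma walk_stays_in_component:
  assumes "walk \<Phi> S u C v" "u \<in> W" "W \<in> spanning_components \<Phi> S"
  shows "walk \<Phi> {e \<in> S. src \<Phi> e \<in> W} u C v \<and> v \<in> W"
  using assms(1,2)
proof (induction rule: walk.induct)
  case (walk_Cons x C v)
  obtain e d where x: "x = (e, d)"
    by (cases x)
  have e: "e \<in> S" "e \<in> ordinary \<Phi>"
    using walk_Cons x by auto
  have "src \<Phi> e \<in> W" "dst \<Phi> e \<in> W"
    using src_dst_same_component[OF assms(3) e] walk_Cons.prems x by (auto split: if_splits)
  then show ?case
    using walk_Cons.IH e x by (auto simp: walk_Cons_iff)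
qed (auto intro: walk.intros)

lemma connected_by_walk:
  assumes "(u, v) \<in> (edge_rel \<Phi> S \<union> (edge_rel \<Phi> S)\<inverse>)\<^sup>*"
  shows "\<exists>C. walk \<Phi> S u C v"
  using assms
proof (induction rule: rtrancl_induct)
  case base
  then show ?case
    by (blast intro: walk.walk_Nil)
next
  case (step y z)
  then obtain C where C: "walk \<Phi> S u C y"
    by blast
  obtain e where e: "e \<in> S" "e \<in> ordinary \<Phi>"
    and yz: "y = src \<Phi> e \<and> z = dst \<Phi> e \<or> z = src \<Phi> e \<and> y = dst \<Phi> e"
    using step(2) by auto
  have "walk \<Phi> S y [(e, y = src \<Phi> e \<and> z = dst \<Phi> e)] z"
    using e yz by (auto simp: walk_Cons_iff walk_Nil_iff)
  then show ?case
    using C walk_append_iff by metis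
qed

definition balanced_components :: "'e set \<Rightarrow> 'v set set" where
  "balanced_components S =
    {W \<in> spanning_components \<Phi> S. balanced G \<Phi> {e \<in> S. src \<Phi> e \<in> W}}"

text \<open>\<open>p v\<close> is the gain of a chosen walk from the root of its component to
  \<open>v\<close>. In a balanced component this gain does not depend on the walk, which yields the
  edge equation; on the other components only membership in the group is claimed.\<close>

lemma potential_exists:
  obtains p where "\<And>v. v \<in> vertices \<Phi> \<Longrightarrow> p v \<in> carrier G"
    and "\<And>e W. \<lbrakk>W \<in> balanced_components S; e \<in> S; e \<in> ordinary \<Phi>; src \<Phi> e \<in> W\<rbrakk> \<Longrightarrow>
      p (dst \<Phi> e) = p (src \<Phi> e) \<otimes> gain \<Phi> e"
proof -
  let ?V = "vertices \<Phi>" and ?R = "edge_rel \<Phi> S"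
  \<comment> \<open>The choice is made from the class, not from \<open>v\<close>, so all vertices of
    a component share one root.\<close>
  define root where "root v = (SOME r. r \<in> component_rel ?V ?R `` {v})" for v
  have root: "root v \<in> W" if "W \<in> components ?V ?R" "v \<in> W" for v W
    unfolding root_def component_unique[OF that, symmetric] using that(2) by (rule someI)
  have root_eq: "root u = root v" if "W \<in> components ?V ?R" "u \<in> W" "v \<in> W" for u v W
    unfolding root_def component_unique[OF that(1,2), symmetric]
      component_unique[OF that(1,3), symmetric] ..
  have "\<exists>C. walk \<Phi> S (root v) C v" if "v \<in> ?V" for v
  proof (rule connected_by_walk)
    have "root v \<in> component_rel ?V ?R `` {v}"
      using root[OF component_of[OF that]] .
    then have "(v, root v) \<in> component_rel ?V ?R"
      by simp
    then have "(root v, v) \<in> component_rel ?V ?R"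
      by (rule component_rel_sym)
    then show "(root v, v) \<in> (?R \<union> ?R\<inverse>)\<^sup>*"
      by simp
  qed
  then obtain w where w: "\<And>v. v \<in> ?V \<Longrightarrow> walk \<Phi> S (root v) (w v) v"
    by metis
  show ?thesis
  proof
    fix v assume "v \<in> ?V"
    then show "circle_gain G \<Phi> (w v) \<in> carrier G"
      using w walk_gain_closed by blast
  next
    fix e W
    assume W: "W \<in> balanced_components S" and e: "e \<in> S" "e \<in> ordinary \<Phi>" "src \<Phi> e \<in> W"
    let ?u = "src \<Phi> e" and ?v = "dst \<Phi> e"
    have W': "W \<in> spanning_components \<Phi> S" and bal: "balanced G \<Phi> {e \<in> S. src \<Phi> e \<in> W}"
      using W by (auto simp: balanced_components_def)
    have V: "?u \<in> ?V" "?v \<in> ?V" and g: "gain \<Phi> e \<in> carrier G"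
      using e wf by (auto simp: wf_gain_graph_def)
    have v: "?v \<in> W"
      using src_dst_same_component[OF W' e(1,2)] e(3) by simp
    have r: "root ?u = root ?v" "root ?u \<in> W"
      using root_eq[OF _ e(3) v] root[OF _ e(3)] W' by (simp_all add: spanning_components_def)
    obtain D where D: "walk \<Phi> S ?v D (root ?u)" "circle_gain G \<Phi> D = inv (circle_gain G \<Phi> (w ?v))"
      using walk_reverse[OF w[OF V(2)]] r by auto
    \<comment> \<open>From the root to \<open>src\<close>, across \<open>e\<close>, and back to the
      root. Neutrality of this closed walk, solved for the gain of \<open>w ?v\<close>, is the
      claim.\<close>
    let ?C = "w ?u @ (e, True) # D"
    have "walk \<Phi> S (root ?u) ?C (root ?u)"
      unfolding walk_append_iff using w[OF V(1)] D(1) e by (auto simp: walk_Cons_iff)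
    then have "walk \<Phi> {e \<in> S. src \<Phi> e \<in> W} (root ?u) ?C (root ?u)"
      using walk_stays_in_component r W' by blast
    then have "circle_gain G \<Phi> ?C = \<one>"
      by (rule closed_walk_neutral[OF bal])
    moreover have "circle_gain G \<Phi> ?C =
        circle_gain G \<Phi> (w ?u) \<otimes> (gain \<Phi> e \<otimes> inv (circle_gain G \<Phi> (w ?v)))"
      using walk_edges[OF w[OF V(1)]] walk_edges[OF D(1)] e D(2)
      by (subst circle_gain_append) auto
    moreover have "circle_gain G \<Phi> (w ?u) \<in> carrier G" "circle_gain G \<Phi> (w ?v) \<in> carrier G"
      using walk_gain_closed w V by blast+
    ultimately show "circle_gain G \<Phi> (w ?v) = circle_gain G \<Phi> (w ?u) \<otimes> gain \<Phi> e"
      using g by (metis inv_closed inv_equality inv_inv m_assoc m_closed)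
  qed
qed

end

section \<open>Counting gain colourings\<close>

lemma sum_minus_one_power_subsets:
  assumes "finite A"
  shows "(\<Sum>S\<in>Pow A. (- 1) ^ card S) = (if A = {} then 1 else 0 :: int)"
  using prod_diff_conv_sum[OF assms, of "\<lambda>_. 1 :: int" "\<lambda>_. 1"] assms by (auto simp: power_0_left)

text \<open>The colours form a set on which the group acts freely apart from one fixed colour \<open>z\<close>; the
  number of colours is the value at which the chromatic polynomial is evaluated.\<close>

locale gain_colouring = finite_gain_graph G \<Phi>
  for G :: "('g, 'b) monoid_scheme" (structure) and \<Phi> :: "('v, 'e, 'g) gain_graph" +
  fixes K :: "'c set" and z :: 'c and act :: "'c \<Rightarrow> 'g \<Rightarrow> 'c"
  assumes finite_K: "finite K" and z_in_K: "z \<in> K"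
    and act_closed: "\<lbrakk>x \<in> K; g \<in> carrier G\<rbrakk> \<Longrightarrow> act x g \<in> K"
    and act_mult: "\<lbrakk>x \<in> K; g \<in> carrier G; h \<in> carrier G\<rbrakk> \<Longrightarrow> act (act x g) h = act x (g \<otimes> h)"
    and act_one: "x \<in> K \<Longrightarrow> act x \<one> = x"
    and act_z: "g \<in> carrier G \<Longrightarrow> act z g = z"
    and act_free: "\<lbrakk>x \<in> K; g \<in> carrier G; act x g = x; x \<noteq> z\<rbrakk> \<Longrightarrow> g = \<one>"
begin

text \<open>A half edge is violated by \<open>z\<close> alone, just as a loop of nonidentity gain
  would be, since such a gain fixes no other colour.\<close>

definition improper :: "('v \<Rightarrow> 'c) \<Rightarrow> 'e \<Rightarrow> bool" where
  "improper f e \<longleftrightarrow>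
    (if e \<in> half \<Phi> then f (src \<Phi> e) = z else f (dst \<Phi> e) = act (f (src \<Phi> e)) (gain \<Phi> e))"

lemma improper_ordinary:
  "e \<in> ordinary \<Phi> \<Longrightarrow> improper f e \<longleftrightarrow> f (dst \<Phi> e) = act (f (src \<Phi> e)) (gain \<Phi> e)"
  using wf by (auto simp: improper_def wf_gain_graph_def)

lemma act_inv_cancel:
  assumes "x \<in> K" "g \<in> carrier G"
  shows "act (act x g) (inv g) = x" "act (act x (inv g)) g = x"
  using assms by (simp_all add: act_mult act_one)

lemma improper_along_walk:
  assumes "walk \<Phi> S u C v" "u \<in> vertices \<Phi>"
    and f: "f \<in> vertices \<Phi> \<rightarrow>\<^sub>E K" "\<forall>e\<in>S. improper f e"
  shows "f v = act (f u) (circle_gain G \<Phi> C)"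
  using assms(1,2)
proof (induction rule: walk.induct)
  case (walk_Nil u)
  then show ?case
    using act_one[OF PiE_mem[OF f(1)]] by simp
next
  case (walk_Cons x C v)
  obtain e d where x: "x = (e, d)"
    by (cases x)
  have e: "e \<in> S" "e \<in> ordinary \<Phi>"
    using walk_Cons x by auto
  have V: "src \<Phi> e \<in> vertices \<Phi>" "dst \<Phi> e \<in> vertices \<Phi>" "gain \<Phi> e \<in> carrier G"
    using e wf by (auto simp: wf_gain_graph_def)
  have K: "f (src \<Phi> e) \<in> K" "f (dst \<Phi> e) \<in> K"
    using f(1) V by auto
  have "f (dst \<Phi> e) = act (f (src \<Phi> e)) (gain \<Phi> e)"
    using f(2) e improper_ordinary[OF e(2), of f] by blast
  moreover from this have "f (src \<Phi> e) = act (f (dst \<Phi> e)) (inv (gain \<Phi> e))"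
    using K V by (simp add: act_inv_cancel)
  ultimately have "f (to_vertex \<Phi> x) = act (f (from_vertex \<Phi> x)) (oriented_gain G \<Phi> x)"
    using x by auto
  moreover have "f v = act (f (to_vertex \<Phi> x)) (circle_gain G \<Phi> C)"
    using walk_Cons.IH V x by auto
  ultimately show ?case
    using walk_gain_closed[OF walk_Cons.hyps(2)] K V x by (auto simp: act_mult)
qed

text \<open>An unbalanced component contains a half edge or a nonneutral circle. Either forces
  \<open>z\<close> at one vertex, and hence throughout the component.\<close>

lemma improper_unbalanced:
  assumes f: "f \<in> vertices \<Phi> \<rightarrow>\<^sub>E K" "\<forall>e\<in>S. improper f e"
    and v: "v \<in> vertices \<Phi>" "v \<notin> \<Union>(balanced_components S)"
  shows "f v = z"
proof -
  let ?V = "vertices \<Phi>" and ?R = "edge_rel \<Phi> S"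
  define W where "W = component_rel ?V ?R `` {v}"
  have W: "W \<in> spanning_components \<Phi> S" "v \<in> W"
    unfolding W_def spanning_components_def by (rule component_of[OF v(1)])+
  have fK: "f u \<in> K" if "u \<in> ?V" for u
    using f(1) that by auto
  have reach: "\<exists>C. walk \<Phi> S u C v" "u \<in> ?V" if "u \<in> W" for u
  proof -
    have "(v, u) \<in> component_rel ?V ?R"
      using that by (simp add: W_def)
    then have "(u, v) \<in> component_rel ?V ?R"
      by (rule component_rel_sym)
    then show "\<exists>C. walk \<Phi> S u C v" "u \<in> ?V"
      using connected_by_walk by auto
  qed
  \<comment> \<open>The group fixes \<open>z\<close>, so this colour is carried along walks
    unchanged.\<close>
  have *: "f v = z" if "u \<in> W" "f u = z" for u
    using reach[OF that(1)] improper_along_walk[OF _ _ f] that(2) walk_gain_closed act_z by metis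
  have "\<not> balanced G \<Phi> {e \<in> S. src \<Phi> e \<in> W}"
    using v(2) W by (auto simp: balanced_components_def)
  then consider e where "e \<in> S" "e \<in> half \<Phi>" "src \<Phi> e \<in> W"
    | C where "circle_in \<Phi> {e \<in> S. src \<Phi> e \<in> W} C" "circle_gain G \<Phi> C \<noteq> \<one>"
    by (auto simp: balanced_def)
  then show ?thesis
  proof cases
    case 1
    then have "f (src \<Phi> e) = z"
      using f(2) by (auto simp: improper_def)
    then show ?thesis
      using * 1 by blast
  next
    case 2
    let ?u = "from_vertex \<Phi> (hd C)"
    have w: "walk \<Phi> {e \<in> S. src \<Phi> e \<in> W} ?u C ?u"
      by (rule walk_of_circle[OF 2(1)])
    have "fst (hd C) \<in> fst ` set C"
      using 2(1) by (simp add: circle_in_def)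
    then have C: "fst (hd C) \<in> S \<inter> ordinary \<Phi>" "src \<Phi> (fst (hd C)) \<in> W"
      using 2(1) unfolding circle_in_def by blast+
    then have u: "?u \<in> W"
      using src_dst_same_component[OF W(1)] by (cases "hd C") auto
    have imp: "\<forall>e\<in>{e \<in> S. src \<Phi> e \<in> W}. improper f e"
      using f(2) by blast
    \<comment> \<open>One turn around the circle shows that a nonidentity element fixes the colour
      of its base vertex; freeness leaves only \<open>z\<close>.\<close>
    have "f ?u = act (f ?u) (circle_gain G \<Phi> C)"
      by (rule improper_along_walk[OF w reach(2)[OF u] f(1) imp])
    then have "f ?u = z"
      using act_free[OF fK[OF reach(2)[OF u]] walk_gain_closed[OF w]] 2(2) by auto
    then show ?thesis
      using * u by blast
  qed
qed

text \<open>Acting by the inverse of the potential turns the edge condition on balanced components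
  into plain constancy and leaves \<open>z\<close> untouched elsewhere. The maps then have one free
  colour per balanced component.\<close>

lemma card_improper:
  assumes "S \<subseteq> edges \<Phi>"
  shows "card {f \<in> vertices \<Phi> \<rightarrow>\<^sub>E K. \<forall>e\<in>S. improper f e} = card K ^ num_balanced G \<Phi> S"
    (is "card ?F = _")
proof -
  let ?V = "vertices \<Phi>" and ?R = "edge_rel \<Phi> S" and ?B = "balanced_components S"
  let ?H = "{f \<in> ?V \<rightarrow>\<^sub>E K. (\<forall>(u, v)\<in>?R. f u = f v) \<and> (\<forall>v\<in>?V - \<Union>?B. f v = z)}"
  obtain p where p: "\<And>v. v \<in> ?V \<Longrightarrow> p v \<in> carrier G"
    and pe: "\<And>e W. \<lbrakk>W \<in> ?B; e \<in> S; e \<in> ordinary \<Phi>; src \<Phi> e \<in> W\<rbrakk> \<Longrightarrow>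
      p (dst \<Phi> e) = p (src \<Phi> e) \<otimes> gain \<Phi> e"
    using potential_exists[of S] by blast
  have V: "src \<Phi> e \<in> ?V" "dst \<Phi> e \<in> ?V" "gain \<Phi> e \<in> carrier G" if "e \<in> ordinary \<Phi>" for e
    using wf that by (auto simp: wf_gain_graph_def)
  have same: "src \<Phi> e \<in> \<Union>?B \<longleftrightarrow> dst \<Phi> e \<in> \<Union>?B" if "e \<in> S" "e \<in> ordinary \<Phi>" for e
    using src_dst_same_component[OF _ that] by (auto simp: balanced_components_def)
  have half: "src \<Phi> e \<notin> \<Union>?B" if "e \<in> S" "e \<in> half \<Phi>" for e
    using that by (auto simp: balanced_components_def balanced_def)
  have "bij_betw (\<lambda>f. \<lambda>v\<in>?V. act (f v) (inv (p v))) ?F ?H"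
  proof (rule bij_betw_byWitness[where f' = "\<lambda>f. \<lambda>v\<in>?V. act (f v) (p v)"])
    show "\<forall>f\<in>?F. (\<lambda>v\<in>?V. act ((\<lambda>v\<in>?V. act (f v) (inv (p v))) v) (p v)) = f"
    proof (intro ballI ext)
      fix f v assume "f \<in> ?F"
      then have f: "f \<in> ?V \<rightarrow>\<^sub>E K"
        by blast
      show "(\<lambda>v\<in>?V. act ((\<lambda>v\<in>?V. act (f v) (inv (p v))) v) (p v)) v = f v"
        using act_inv_cancel[OF PiE_mem[OF f] p, of v v] PiE_arb[OF f, of v] by simp
    qed
    show "\<forall>f\<in>?H. (\<lambda>v\<in>?V. act ((\<lambda>v\<in>?V. act (f v) (p v)) v) (inv (p v))) = f"
    proof (intro ballI ext)
      fix f v assume "f \<in> ?H"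
      then have f: "f \<in> ?V \<rightarrow>\<^sub>E K"
        by blast
      show "(\<lambda>v\<in>?V. act ((\<lambda>v\<in>?V. act (f v) (p v)) v) (inv (p v))) v = f v"
        using act_inv_cancel[OF PiE_mem[OF f] p, of v v] PiE_arb[OF f, of v] by simp
    qed
    show "(\<lambda>f. \<lambda>v\<in>?V. act (f v) (inv (p v))) ` ?F \<subseteq> ?H"
    proof (rule image_subsetI)
      fix f assume "f \<in> ?F"
      then have f: "f \<in> ?V \<rightarrow>\<^sub>E K" "\<forall>e\<in>S. improper f e"
        by auto
      let ?f = "\<lambda>v\<in>?V. act (f v) (inv (p v))"
      have fK: "f v \<in> K" if "v \<in> ?V" for v
        using f(1) that by auto
      have out: "?f v = z" if "v \<in> ?V - \<Union>?B" for v
        using improper_unbalanced[OF f, of v] that p act_z by auto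
      have "?f (src \<Phi> e) = ?f (dst \<Phi> e)" if e: "e \<in> S" "e \<in> ordinary \<Phi>" for e
      proof (cases "src \<Phi> e \<in> \<Union>?B")
        case True
        then have pd: "p (dst \<Phi> e) = p (src \<Phi> e) \<otimes> gain \<Phi> e"
          using pe e by blast
        have "f (dst \<Phi> e) = act (f (src \<Phi> e)) (gain \<Phi> e)"
          using f(2) e improper_ordinary[OF e(2), of f] by blast
        \<comment> \<open>The inverse of \<open>p (dst \<Phi> e)\<close> first undoes the gain of
          \<open>e\<close> and then acts as the inverse of \<open>p (src \<Phi> e)\<close>.\<close>
        then show ?thesis
          using V[OF e(2)] fK p pd
          by (simp add: act_mult inv_mult_group m_assoc[symmetric])
      next
        case False
        then show ?thesis
          using out V[OF e(2)] same[OF e] by blast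
      qed
      moreover have "?f \<in> ?V \<rightarrow>\<^sub>E K"
        using fK p act_closed by auto
      ultimately show "?f \<in> ?H"
        using out by blast
    qed
    show "(\<lambda>f. \<lambda>v\<in>?V. act (f v) (p v)) ` ?H \<subseteq> ?F"
    proof (rule image_subsetI)
      fix f assume "f \<in> ?H"
      then have f: "f \<in> ?V \<rightarrow>\<^sub>E K" "\<And>e. e \<in> S \<Longrightarrow> e \<in> ordinary \<Phi> \<Longrightarrow> f (src \<Phi> e) = f (dst \<Phi> e)"
        and fz: "\<And>v. v \<in> ?V \<Longrightarrow> v \<notin> \<Union>?B \<Longrightarrow> f v = z"
        by auto
      let ?f = "\<lambda>v\<in>?V. act (f v) (p v)"
      have fK: "f v \<in> K" if "v \<in> ?V" for v
        using f(1) that by auto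
      have out: "?f v = z" if "v \<in> ?V" "v \<notin> \<Union>?B" for v
        using fz[OF that] that p act_z by simp
      have "improper ?f e" if e: "e \<in> S" for e
      proof (cases "e \<in> half \<Phi>")
        case True
        then have "src \<Phi> e \<in> ?V"
          using wf by (auto simp: wf_gain_graph_def)
        then show ?thesis
          using out[OF _ half[OF e True]] True by (simp add: improper_def)
      next
        case False
        then have o: "e \<in> ordinary \<Phi>"
          using assms e by (auto simp: edges_def)
        show ?thesis
        proof (cases "src \<Phi> e \<in> \<Union>?B")
          case True
          then have "p (dst \<Phi> e) = p (src \<Phi> e) \<otimes> gain \<Phi> e"
            using pe e o by blast
          then show ?thesis
            using V[OF o] fK p f(2)[OF e o] o by (simp add: improper_ordinary act_mult)
        next
          case False
          then have "?f (src \<Phi> e) = z" "?f (dst \<Phi> e) = z"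
            using out V[OF o] same[OF e o] by blast+
          then show ?thesis
            using o V(3)[OF o] by (simp only: improper_ordinary act_z)
        qed
      qed
      moreover have "?f \<in> ?V \<rightarrow>\<^sub>E K"
        using fK p act_closed by auto
      ultimately show "?f \<in> ?F"
        by blast
    qed
  qed
  then have "card ?F = card ?H"
    by (rule bij_betw_same_card)
  also have "\<dots> = card K ^ card ?B"
  proof (rule card_constant_on_components)
    show "finite ?V"
      using wf by (simp add: wf_gain_graph_def)
    show "?B \<subseteq> components ?V ?R"
      by (auto simp: balanced_components_def spanning_components_def)
  qed (use z_in_K edge_rel_subset in auto)
  finally show ?thesis
    by (simp add: num_balanced_def balanced_components_def)
qed

lemma gain_chromatic_poly_counts:
  "poly (gain_chromatic_poly G \<Phi>) (int (card K)) =
    int (card {f \<in> vertices \<Phi> \<rightarrow>\<^sub>E K. \<forall>e\<in>edges \<Phi>. \<not> improper f e})"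
proof -
  let ?F = "vertices \<Phi> \<rightarrow>\<^sub>E K" and ?P = "Pow (edges \<Phi>)"
  have finE: "finite (edges \<Phi>)" and finF: "finite ?F"
    using wf finite_K by (auto simp: wf_gain_graph_def edges_def intro: finite_PiE)
  have "poly (gain_chromatic_poly G \<Phi>) (int (card K)) =
      (\<Sum>S\<in>?P. (- 1) ^ card S * int (card K ^ num_balanced G \<Phi> S))"
    by (simp add: gain_chromatic_poly_def poly_sum poly_monom)
  also have "\<dots> = (\<Sum>S\<in>?P. (- 1) ^ card S * int (card {f \<in> ?F. \<forall>e\<in>S. improper f e}))"
    using card_improper by (intro sum.cong) auto
  also have "\<dots> = (\<Sum>S\<in>?P. \<Sum>f\<in>?F. if \<forall>e\<in>S. improper f e then (- 1) ^ card S else 0)"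
    using finF by (intro sum.cong refl) (simp add: sum.If_cases Int_def)
  also have "\<dots> = (\<Sum>f\<in>?F. \<Sum>S\<in>?P. if \<forall>e\<in>S. improper f e then (- 1) ^ card S else 0)"
    by (rule sum.swap)
  also have "\<dots> = (\<Sum>f\<in>?F. if \<forall>e\<in>edges \<Phi>. \<not> improper f e then 1 else 0)"
  proof (rule sum.cong[OF refl])
    fix f
    \<comment> \<open>For fixed \<open>f\<close> only sets of violated edges contribute, and with
      \<open>m\<close> violated edges their signs sum to \<open>(1 - 1) ^ m\<close>.\<close>
    have "(\<Sum>S\<in>?P. if \<forall>e\<in>S. improper f e then (- 1) ^ card S else 0) =
        (\<Sum>S\<in>Pow {e \<in> edges \<Phi>. improper f e}. (- 1) ^ card S :: int)"
      using finE by (intro sum.mono_neutral_cong_right) auto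
    also have "\<dots> = (if {e \<in> edges \<Phi>. improper f e} = {} then 1 else 0)"
      by (rule sum_minus_one_power_subsets) (use finE in auto)
    finally show "(\<Sum>S\<in>?P. if \<forall>e\<in>S. improper f e then (- 1) ^ card S else 0) =
        (if \<forall>e\<in>edges \<Phi>. \<not> improper f e then 1 else 0 :: int)"
      by auto
  qed
  also have "\<dots> = int (card {f \<in> ?F. \<forall>e\<in>edges \<Phi>. \<not> improper f e})"
    using finF by (simp add: sum.If_cases Int_def)
  finally show ?thesis .
qed

end

section \<open>Deletion and contraction\<close>

text \<open>Ordinary chromatic polynomials are identified by their values at all naturals, those of
  expansions by their values at the numbers \<open>\<gamma> k + 1\<close> only.\<close>

lemma poly_eq_on_infinite:
  fixes p q :: "int poly"
  assumes "infinite A" "\<And>x. x \<in> A \<Longrightarrow> poly p x = poly q x"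
  shows "p = q"
proof (rule ccontr)
  assume "p \<noteq> q"
  then have "finite {x. poly (p - q) x = 0}"
    by (intro poly_roots_finite) simp
  moreover have "A \<subseteq> {x. poly (p - q) x = 0}"
    using assms(2) by auto
  ultimately show False
    using assms(1) finite_subset by blast
qed

lemma poly_eq_on_nat:
  fixes p q :: "int poly"
  assumes "\<And>k. poly p (int k) = poly q (int k)"
  shows "p = q"
proof (rule poly_eq_on_infinite)
  show "infinite (range int)"
    by (simp add: range_inj_infinite)
qed (use assms in auto)

lemma signless_whitney_eq:
  "signless_whitney m p i = (if i \<le> m then (- 1) ^ i * coeff p (m - i) else 0)"
proof (cases "i \<le> m")
  case True
  have "coeff (p \<circ>\<^sub>p [:0, - 1:]) d = (- 1) ^ d * coeff p d" for d
    by (rule coeff_pcompose_linear)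
  \<comment> \<open>The normalising sign and the sign from substituting \<open>- \<lambda>\<close>
    combine to \<open>(- 1) ^ i\<close>, because their exponents add up to \<open>i\<close> modulo
    2.\<close>
  moreover have "(- 1) ^ m * (- 1) ^ (m - i) = ((- 1) ^ i :: int)"
  proof -
    have "m + (m - i) = i + 2 * (m - i)"
      using True by simp
    then show ?thesis
      by (metis power_add power_minus1_even mult.right_neutral)
  qed
  ultimately show ?thesis
    using True by (simp add: signless_whitney_def signless_poly_def mult.assoc[symmetric])
qed (simp add: signless_whitney_def)

section \<open>Simple graphs and their component counts\<close>

lemma simple_graphD:
  assumes "simple_graph V E"
  shows "finite V" "finite E" "\<And>a b. {a, b} \<in> E \<Longrightarrow> a \<in> V \<and> b \<in> V \<and> a \<noteq> b"
proof -
  show V: "finite V"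
    using assms by (simp add: simple_graph_def)
  have "E \<subseteq> Pow V"
    using assms by (auto simp: simple_graph_def)
  then show "finite E"
    using V finite_subset by blast
  show "a \<in> V \<and> b \<in> V \<and> a \<noteq> b" if "{a, b} \<in> E" for a b
    using assms that by (force simp: simple_graph_def card_2_iff)
qed

lemma simple_graph_edgeE:
  assumes "simple_graph V E" "e \<in> E"
  obtains a b where "e = {a, b}" "a \<in> V" "b \<in> V" "a \<noteq> b"
proof -
  have "e \<subseteq> V" "card e = 2"
    using assms by (auto simp: simple_graph_def)
  then show ?thesis
    using that by (auto simp: card_2_iff)
qed

lemma simple_graph_subset: "simple_graph V E \<Longrightarrow> F \<subseteq> E \<Longrightarrow> simple_graph V F"
  by (auto simp: simple_graph_def)

text \<open>With \<open>(\<noteq>)\<close> for \<open>P\<close> these are the proper colourings,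
  with \<open>(=)\<close> the maps constant on components; the contraction bijection is thus proved
  once for both.\<close>

definition edge_maps :: "('c \<Rightarrow> 'c \<Rightarrow> bool) \<Rightarrow> 'v set \<Rightarrow> 'v set set \<Rightarrow> 'c set \<Rightarrow> ('v \<Rightarrow> 'c) set" where
  "edge_maps P V E K = {f \<in> V \<rightarrow>\<^sub>E K. \<forall>a b. {a, b} \<in> E \<longrightarrow> P (f a) (f b)}"

lemma proper_colorings_eq: "proper_colorings V E k = edge_maps (\<noteq>) V E {..<k}"
  by (simp add: proper_colorings_def edge_maps_def)

lemma finite_edge_maps: "finite V \<Longrightarrow> finite K \<Longrightarrow> finite (edge_maps P V E K)"
  by (simp add: edge_maps_def finite_PiE)

lemma card_constant_edge_maps:
  assumes "simple_graph V E" "K \<noteq> {}"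
  shows "card (edge_maps (=) V E K) = card K ^ card (graph_components V E)"
proof -
  obtain z where z: "z \<in> K"
    using assms(2) by blast
  let ?R = "{(u, v). {u, v} \<in> E}"
  have "edge_maps (=) V E K = {f \<in> V \<rightarrow>\<^sub>E K. (\<forall>(u, v)\<in>?R. f u = f v) \<and>
      (\<forall>v\<in>V - \<Union>(components V ?R). f v = z)}"
    unfolding edge_maps_def Union_components by blast
  also have "card \<dots> = card K ^ card (components V ?R)"
    using simple_graphD[OF assms(1)] z by (intro card_constant_on_components) auto
  finally show ?thesis
    by (simp add: graph_components_def)
qed

text \<open>Two values already determine the number of components, so component counts can be
  compared by comparing finite sets of maps.\<close>

lemma card_constant_bool_maps:
  assumes "simple_graph V E"
  shows "card (edge_maps (=) V E (UNIV :: bool set)) = 2 ^ card (graph_components V E)"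
  using card_constant_edge_maps[OF assms, of "UNIV :: bool set"] by simp

lemma graph_components_le:
  assumes "simple_graph V E"
  shows "card (graph_components V E) \<le> card V"
proof -
  have "2 ^ card (graph_components V E) = card (edge_maps (=) V E (UNIV :: bool set))"
    using card_constant_bool_maps[OF assms] by simp
  also have "\<dots> \<le> card (V \<rightarrow>\<^sub>E (UNIV :: bool set))"
    using simple_graphD(1)[OF assms] by (intro card_mono) (auto simp: edge_maps_def intro: finite_PiE)
  also have "\<dots> = 2 ^ card V"
    using simple_graphD(1)[OF assms] by (simp add: card_PiE)
  finally show ?thesis
    by simp
qed

lemma graph_components_antimono:
  assumes "simple_graph V E" "F \<subseteq> E"
  shows "card (graph_components V E) \<le> card (graph_components V F)"
proof -
  have "card (edge_maps (=) V E (UNIV :: bool set)) \<le> card (edge_maps (=) V F (UNIV :: bool set))"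
    using simple_graphD(1)[OF assms(1)] assms(2)
    by (intro card_mono finite_edge_maps) (auto simp: edge_maps_def)
  then show ?thesis
    using card_constant_bool_maps[OF assms(1)]
      card_constant_bool_maps[OF simple_graph_subset[OF assms]] by simp
qed

lemma graph_components_no_edges: "finite V \<Longrightarrow> card (graph_components V {}) = card V"
  using card_constant_bool_maps[of V "{}"]
  by (simp add: simple_graph_def edge_maps_def card_PiE)

section \<open>Contraction of an edge\<close>

definition contract_edges :: "'v \<Rightarrow> 'v \<Rightarrow> 'v set set \<Rightarrow> 'v set set" where
  "contract_edges u v E = (\<lambda>e. if v \<in> e then insert u (e - {v}) else e) ` (E - {{u, v}})"

text \<open>Only \<open>{u, v}\<close> itself would collapse to a single vertex, and it is removed
  before the renaming. Edges that become parallel merge, which does not change the conditions they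
  impose on maps.\<close>

lemma simple_graph_contract:
  assumes "simple_graph V E" "{u, v} \<in> E"
  shows "simple_graph (V - {v}) (contract_edges u v E)"
proof -
  have uv: "u \<in> V" "u \<noteq> v"
    using simple_graphD(3)[OF assms] by auto
  have "(if v \<in> e then insert u (e - {v}) else e) \<subseteq> V - {v} \<and>
      card (if v \<in> e then insert u (e - {v}) else e) = 2" if e: "e \<in> E" "e \<noteq> {u, v}" for e
  proof -
    obtain a b where "e = {a, b}" "a \<in> V" "b \<in> V" "a \<noteq> b"
      using simple_graph_edgeE[OF assms(1) e(1)] .
    then show ?thesis
      using e(2) uv by (cases "v = a"; cases "v = b") (auto simp: insert_Diff_if insert_commute)
  qed
  then show ?thesis
    using simple_graphD(1)[OF assms(1)] unfolding simple_graph_def contract_edges_def by blast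
qed

lemma card_contract_less:
  assumes "simple_graph V E" "{u, v} \<in> E"
  shows "card (contract_edges u v E) < card E"
proof -
  have "card (contract_edges u v E) \<le> card (E - {{u, v}})"
    unfolding contract_edges_def using simple_graphD(2)[OF assms(1)] by (intro card_image_le) auto
  also have "\<dots> < card E"
    using simple_graphD(2)[OF assms(1)] assms(2) by (rule card_Diff1_less)
  finally show ?thesis .
qed

text \<open>Since \<open>f u = f v\<close>, renaming \<open>v\<close> to \<open>u\<close> leaves the
  values seen by \<open>P\<close> unchanged; symmetry of \<open>P\<close> takes care of the
  unordered pairs.\<close>

lemma edge_property_contract:
  assumes "simple_graph V E" "{u, v} \<in> E" "symp P" "f u = f v"
  shows "(\<forall>a b. {a, b} \<in> contract_edges u v E \<longrightarrow> P (f a) (f b)) \<longleftrightarrow>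
    (\<forall>a b. {a, b} \<in> E - {{u, v}} \<longrightarrow> P (f a) (f b))" (is "?L \<longleftrightarrow> ?R")
proof
  assume L: ?L
  show ?R
  proof (intro allI impI)
    fix a b assume ab: "{a, b} \<in> E - {{u, v}}"
    then have "a \<noteq> b"
      using simple_graphD(3)[OF assms(1)] by blast
    have "(if v \<in> {a, b} then insert u ({a, b} - {v}) else {a, b}) \<in> contract_edges u v E"
      unfolding contract_edges_def using ab by (rule imageI)
    moreover have "(if v \<in> {a, b} then insert u ({a, b} - {v}) else {a, b}) =
        {if a = v then u else a, if b = v then u else b}"
      using \<open>a \<noteq> b\<close> by auto
    ultimately have "P (f (if a = v then u else a)) (f (if b = v then u else b))"
      using L by simp
    then show "P (f a) (f b)"
      using assms(4) by (simp split: if_splits)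
  qed
next
  assume R: ?R
  show ?L
  proof (intro allI impI)
    fix a b assume "{a, b} \<in> contract_edges u v E"
    then obtain e where e: "e \<in> E" "e \<noteq> {u, v}"
      and eq: "{a, b} = (if v \<in> e then insert u (e - {v}) else e)"
      unfolding contract_edges_def by blast
    show "P (f a) (f b)"
    proof (cases "v \<in> e")
      case False
      then show ?thesis
        using R e eq by auto
    next
      case True
      then obtain w where w: "e = {v, w}" "w \<noteq> v"
        using simple_graph_edgeE[OF assms(1) e(1)] by (metis doubleton_eq_iff insert_iff singletonD)
      then have "P (f v) (f w)" "P (f w) (f v)"
        using R e sympD[OF assms(3)] by auto
      moreover have "{a, b} = {u, w}"
        using eq w by auto
      ultimately show ?thesis
        using assms(4) by (auto simp: doubleton_eq_iff)
    qed
  qed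
qed

text \<open>Once the two ends agree, the value at \<open>v\<close> is redundant: restriction forgets
  it, and copying the value at \<open>u\<close> restores it.\<close>

lemma card_edge_maps_contract:
  assumes "simple_graph V E" "{u, v} \<in> E" "symp P"
  shows "card {f \<in> edge_maps P V (E - {{u, v}}) K. f u = f v} =
    card (edge_maps P (V - {v}) (contract_edges u v E) K)" (is "card ?F = card ?H")
proof -
  have uv: "u \<in> V" "v \<in> V" "u \<noteq> v"
    using simple_graphD(3)[OF assms(1,2)] by auto
  have sg: "simple_graph (V - {v}) (contract_edges u v E)"
    by (rule simple_graph_contract[OF assms(1,2)])
  have "bij_betw (\<lambda>f. restrict f (V - {v})) ?F ?H"
  proof (rule bij_betw_byWitness[where f' = "\<lambda>f. f(v := f u)"])
    show "\<forall>f\<in>?F. (restrict f (V - {v}))(v := restrict f (V - {v}) u) = f"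
    proof (intro ballI ext)
      fix f x assume "f \<in> ?F"
      then have "f \<in> V \<rightarrow>\<^sub>E K" "f u = f v"
        by (auto simp: edge_maps_def)
      then show "((restrict f (V - {v}))(v := restrict f (V - {v}) u)) x = f x"
        using uv PiE_arb[of f V "\<lambda>_. K" x] by auto
    qed
    show "\<forall>f\<in>?H. restrict (f(v := f u)) (V - {v}) = f"
    proof (intro ballI ext)
      fix f x assume "f \<in> ?H"
      then have "f \<in> (V - {v}) \<rightarrow>\<^sub>E K"
        by (auto simp: edge_maps_def)
      then show "restrict (f(v := f u)) (V - {v}) x = f x"
        using PiE_arb[of f "V - {v}" "\<lambda>_. K" x] by auto
    qed
    show "(\<lambda>f. restrict f (V - {v})) ` ?F \<subseteq> ?H"
    proof (rule image_subsetI)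
      fix f assume f: "f \<in> ?F"
      then have "\<forall>a b. {a, b} \<in> contract_edges u v E \<longrightarrow> P (f a) (f b)"
        using edge_property_contract[OF assms, of f] by (simp add: edge_maps_def)
      moreover have "restrict f (V - {v}) \<in> (V - {v}) \<rightarrow>\<^sub>E K"
        using f by (auto simp: edge_maps_def)
      ultimately show "restrict f (V - {v}) \<in> ?H"
        using simple_graphD(3)[OF sg] by (auto simp: edge_maps_def)
    qed
    show "(\<lambda>f. f(v := f u)) ` ?H \<subseteq> ?F"
    proof (rule image_subsetI)
      fix f assume f: "f \<in> ?H"
      let ?f = "f(v := f u)"
      have "P (?f a) (?f b)" if "{a, b} \<in> contract_edges u v E" for a b
        using f simple_graphD(3)[OF sg that] that by (simp add: edge_maps_def)
      then have "\<forall>a b. {a, b} \<in> E - {{u, v}} \<longrightarrow> P (?f a) (?f b)"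
        using edge_property_contract[OF assms, of ?f] uv by simp
      moreover have "?f \<in> V \<rightarrow>\<^sub>E K"
      proof (rule PiE_I)
        fix x assume "x \<in> V"
        then show "?f x \<in> K"
          using f uv by (auto simp: edge_maps_def intro: PiE_mem)
      next
        fix x assume "x \<notin> V"
        then show "?f x = undefined"
          using f uv PiE_arb[of f "V - {v}" "\<lambda>_. K" x] by (auto simp: edge_maps_def)
      qed
      ultimately show "?f \<in> ?F"
        using uv by (simp add: edge_maps_def)
    qed
  qed
  then show ?thesis
    by (rule bij_betw_same_card)
qed

text \<open>Constancy along \<open>{u, v}\<close> is the condition \<open>f u = f v\<close>, so the
  maps constant along \<open>E\<close> are precisely those that match maps of the
  contraction.\<close>

lemma graph_components_contract:
  assumes "simple_graph V E" "{u, v} \<in> E"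
  shows "card (graph_components (V - {v}) (contract_edges u v E)) = card (graph_components V E)"
proof -
  have "edge_maps (=) V E (UNIV :: bool set) = {f \<in> edge_maps (=) V (E - {{u, v}}) (UNIV :: bool set). f u = f v}"
    using assms(2) unfolding edge_maps_def by (auto simp: doubleton_eq_iff)
  then have "(2::nat) ^ card (graph_components V E) =
      2 ^ card (graph_components (V - {v}) (contract_edges u v E))"
    using card_constant_bool_maps[OF assms(1)]
      card_constant_bool_maps[OF simple_graph_contract[OF assms]]
      card_edge_maps_contract[OF assms, of "(=)" "UNIV :: bool set"] by (simp add: sympI)
  then show ?thesis
    by simp
qed

section \<open>Chromatic polynomials and Whitney numbers by deletion and contraction\<close>

lemma card_proper_deletion_contraction:
  assumes "simple_graph V E" "{u, v} \<in> E"
  shows "card (proper_colorings V (E - {{u, v}}) k) =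
    card (proper_colorings V E k) + card (proper_colorings (V - {v}) (contract_edges u v E) k)"
proof -
  let ?F = "proper_colorings V (E - {{u, v}}) k"
  have "finite ?F"
    using simple_graphD(1)[OF assms(1)] by (simp add: proper_colorings_eq finite_edge_maps)
  then have "card ?F = card {f \<in> ?F. f u \<noteq> f v} + card {f \<in> ?F. f u = f v}"
    by (subst card_Un_disjoint[symmetric]) (auto intro: arg_cong[where f = card])
  moreover have "{f \<in> ?F. f u \<noteq> f v} = proper_colorings V E k"
    using assms(2) unfolding proper_colorings_def by (auto simp: doubleton_eq_iff) metis+
  moreover have "card {f \<in> ?F. f u = f v} = card (proper_colorings (V - {v}) (contract_edges u v E) k)"
    unfolding proper_colorings_eq by (rule card_edge_maps_contract[OF assms]) (simp add: symp_def)
  ultimately show ?thesis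
    by simp
qed

text \<open>Induction on the number of edges: deletion loses exactly one, contraction at least one,
  since edges may merge.\<close>

lemma deletion_contraction_induct [consumes 1, case_names no_edges edge]:
  assumes "simple_graph V E"
    and "\<And>V. finite V \<Longrightarrow> P V {}"
    and "\<And>V E u v. \<lbrakk>simple_graph V E; {u, v} \<in> E; P V (E - {{u, v}});
      P (V - {v}) (contract_edges u v E)\<rbrakk> \<Longrightarrow> P V E"
  shows "P V E"
  using assms(1)
proof (induction "card E" arbitrary: V E rule: less_induct)
  case less
  show ?case
  proof (cases "E = {}")
    case True
    then show ?thesis
      using assms(2) simple_graphD(1)[OF less.prems] by simp
  next
    case False
    then obtain u v where e: "{u, v} \<in> E"
      using simple_graph_edgeE[OF less.prems] by (metis ex_in_conv)
    show ?thesis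
    proof (rule assms(3)[OF less.prems e])
      show "P V (E - {{u, v}})"
        using less.hyps[OF _ simple_graph_subset[OF less.prems]] card_Diff1_less[OF _ e]
          simple_graphD(2)[OF less.prems] by blast
      show "P (V - {v}) (contract_edges u v E)"
        by (rule less.hyps[OF card_contract_less[OF less.prems e]
              simple_graph_contract[OF less.prems e]])
    qed
  qed
qed

text \<open>Existence gives meaning to the definite description in \<open>chromatic_poly\<close>.
  The degree bound is carried along because Whitney numbers are read downwards from degree
  \<open>card V\<close>.\<close>

lemma chromatic_poly_exists:
  assumes "simple_graph V E"
  shows "\<exists>p. degree p \<le> card V \<and> (\<forall>k. poly p (int k) = int (card (proper_colorings V E k)))"
  using assms
proof (induction rule: deletion_contraction_induct)
  case (no_edges V)
  then show ?case
    by (intro exI[of _ "monom 1 (card V)"])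
      (auto simp: proper_colorings_def poly_monom card_PiE degree_monom_le)
next
  case (edge V E u v)
  then obtain p q where p: "degree p \<le> card V"
      "\<forall>k. poly p (int k) = int (card (proper_colorings V (E - {{u, v}}) k))"
    and q: "degree q \<le> card (V - {v})"
      "\<forall>k. poly q (int k) = int (card (proper_colorings (V - {v}) (contract_edges u v E) k))"
    by blast
  have "card (V - {v}) \<le> card V"
    by (rule card_Diff1_le)
  then have "degree (p - q) \<le> card V"
    using p(1) q(1) by (intro degree_diff_le) auto
  moreover have "poly (p - q) (int k) = int (card (proper_colorings V E k))" for k
    using p(2) q(2) card_proper_deletion_contraction[OF edge(1,2), of k] by simp
  ultimately show ?case
    by blast
qed

lemma chromatic_poly_eqI:
  assumes "\<And>k. poly p (int k) = int (card (proper_colorings V E k))"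
  shows "chromatic_poly V E = p"
  unfolding chromatic_poly_def
  by (rule the_equality) (use assms in \<open>auto intro: poly_eq_on_nat\<close>)

lemma chromatic_poly_works:
  assumes "simple_graph V E"
  shows "degree (chromatic_poly V E) \<le> card V"
    and "poly (chromatic_poly V E) (int k) = int (card (proper_colorings V E k))"
  using chromatic_poly_exists[OF assms] chromatic_poly_eqI by metis+

lemma chromatic_poly_deletion_contraction:
  assumes "simple_graph V E" "{u, v} \<in> E"
  shows "chromatic_poly V E =
    chromatic_poly V (E - {{u, v}}) - chromatic_poly (V - {v}) (contract_edges u v E)"
  by (rule chromatic_poly_eqI)
    (simp add: chromatic_poly_works(2) simple_graph_subset[OF assms(1)] simple_graph_contract[OF assms]
      card_proper_deletion_contraction[OF assms])

lemma graph_whitney_eq: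
  "graph_whitney V E i =
    (if i \<le> card V then (- 1) ^ i * coeff (chromatic_poly V E) (card V - i) else 0)"
  by (simp add: graph_whitney_def signless_whitney_eq)

lemma poly_chromatic_poly:
  assumes "simple_graph V E"
  shows "poly (chromatic_poly V E) x =
    (\<Sum>j=0..card V. (- 1) ^ j * graph_whitney V E j * x ^ (card V - j))"
proof -
  have "poly (chromatic_poly V E) x = (\<Sum>d\<le>card V. coeff (chromatic_poly V E) d * x ^ d)"
    unfolding poly_altdef using chromatic_poly_works(1)[OF assms]
    by (intro sum.mono_neutral_left) (auto simp: coeff_eq_0)
  also have "\<dots> = (\<Sum>j=0..card V. coeff (chromatic_poly V E) (card V - j) * x ^ (card V - j))"
    by (rule sum.reindex_bij_witness[of _ "\<lambda>j. card V - j" "\<lambda>j. card V - j"]) auto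
  also have "\<dots> = (\<Sum>j=0..card V. (- 1) ^ j * graph_whitney V E j * x ^ (card V - j))"
    by (intro sum.cong) (auto simp: graph_whitney_eq mult.assoc[symmetric] power_add[symmetric])
  finally show ?thesis .
qed

text \<open>The contraction has one vertex fewer, so the same power of \<open>\<lambda>\<close> has
  index \<open>i\<close> there instead of \<open>Suc i\<close>. The sign gained by this shift turns
  the difference of chromatic polynomials into a sum.\<close>

lemma graph_whitney_deletion_contraction:
  assumes "simple_graph V E" "{u, v} \<in> E"
  shows "graph_whitney V E 0 = graph_whitney V (E - {{u, v}}) 0"
    and "graph_whitney V E (Suc i) =
      graph_whitney V (E - {{u, v}}) (Suc i) + graph_whitney (V - {v}) (contract_edges u v E) i"
proof -
  have v: "v \<in> V" "finite V"
    using simple_graphD[OF assms(1)] assms(2) by auto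
  have n: "card V = Suc (card (V - {v}))"
    by (rule card.remove[OF v(2,1)])
  \<comment> \<open>The contraction has too small a degree to affect the leading
    coefficient.\<close>
  have "coeff (chromatic_poly (V - {v}) (contract_edges u v E)) (card V) = 0"
    using chromatic_poly_works(1)[OF simple_graph_contract[OF assms]] n by (intro coeff_eq_0) simp
  then show "graph_whitney V E 0 = graph_whitney V (E - {{u, v}}) 0"
    by (simp add: graph_whitney_eq chromatic_poly_deletion_contraction[OF assms])
  show "graph_whitney V E (Suc i) =
      graph_whitney V (E - {{u, v}}) (Suc i) + graph_whitney (V - {v}) (contract_edges u v E) i"
    unfolding graph_whitney_eq chromatic_poly_deletion_contraction[OF assms] n
    by (simp add: algebra_simps)
qed

text \<open>The contraction has rank exactly one less and supplies positivity. The rank of the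
  deletion is at most that of the graph, so its Whitney numbers vanish in time; otherwise only their
  nonnegativity matters, and this needs both halves of the induction hypothesis.\<close>

lemma graph_whitney_support:
  assumes "simple_graph V E"
  shows "\<forall>i. (i \<le> card V - card (graph_components V E) \<longrightarrow> graph_whitney V E i > 0) \<and>
    (i > card V - card (graph_components V E) \<longrightarrow> graph_whitney V E i = 0)"
  using assms
proof (induction rule: deletion_contraction_induct)
  case (no_edges V)
  have "chromatic_poly V {} = monom 1 (card V)"
    using no_edges by (intro chromatic_poly_eqI) (simp add: proper_colorings_def poly_monom card_PiE)
  then show ?case
    using no_edges by (auto simp: graph_components_no_edges graph_whitney_eq)
next
  case (edge V E u v)
  note dc = graph_whitney_deletion_contraction[OF edge(1,2)]
  have v: "v \<in> V" "finite V"
    using simple_graphD[OF edge(1)] edge(2) by auto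
  have n: "card V = Suc (card (V - {v}))"
    by (rule card.remove[OF v(2,1)])
  let ?c = "card (graph_components V E)" and ?d = "card (graph_components V (E - {{u, v}}))"
  have c: "card (graph_components (V - {v}) (contract_edges u v E)) = ?c"
    by (rule graph_components_contract[OF edge(1,2)])
  have "?c \<le> ?d"
    by (rule graph_components_antimono[OF edge(1)]) blast
  \<comment> \<open>Keeps the truncated subtraction in the rank of the contraction exact.\<close>
  have "?c \<le> card (V - {v})"
    using graph_components_le[OF simple_graph_contract[OF edge(1,2)]] c by simp
  have nonneg: "graph_whitney V (E - {{u, v}}) i \<ge> 0" for i
    using edge.IH(1)[rule_format, of i] by (cases "i \<le> card V - ?d") auto
  show ?case
  proof (intro allI)
    fix i
    show "(i \<le> card V - ?c \<longrightarrow> graph_whitney V E i > 0) \<and>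
      (i > card V - ?c \<longrightarrow> graph_whitney V E i = 0)"
    proof (cases i)
      case 0
      then show ?thesis
        using edge.IH(1)[rule_format, of 0] dc(1) by simp
    next
      case (Suc j)
      have "graph_whitney V E i > 0" if "i \<le> card V - ?c"
      proof -
        have "j \<le> card (V - {v}) - ?c"
          using that n Suc \<open>?c \<le> card (V - {v})\<close> by linarith
        then have "graph_whitney (V - {v}) (contract_edges u v E) j > 0"
          using edge.IH(2) unfolding c by blast
        then show ?thesis
          using nonneg[of i] dc(2)[of j] unfolding Suc by linarith
      qed
      moreover have "graph_whitney V E i = 0" if "i > card V - ?c"
      proof -
        have "j > card (V - {v}) - ?c" "i > card V - ?d"
          using that n Suc \<open>?c \<le> card (V - {v})\<close> \<open>?c \<le> ?d\<close> by linarith+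
        then have "graph_whitney (V - {v}) (contract_edges u v E) j = 0"
            "graph_whitney V (E - {{u, v}}) i = 0"
          using edge.IH unfolding c by blast+
        then show ?thesis
          using dc(2)[of j] unfolding Suc by linarith
      qed
      ultimately show ?thesis
        by blast
    qed
  qed
qed

lemma graph_whitney_pos:
  "simple_graph V E \<Longrightarrow> i \<le> card V - card (graph_components V E) \<Longrightarrow> graph_whitney V E i > 0"
  using graph_whitney_support by blast

lemma graph_whitney_zero:
  "simple_graph V E \<Longrightarrow> i > card V - card (graph_components V E) \<Longrightarrow> graph_whitney V E i = 0"
  using graph_whitney_support by blast

section \<open>Deletion of vertices\<close>

lemma card_proper_colorings_isolated:
  assumes "simple_graph (V - Y) E" "Y \<subseteq> V" "finite V"
  shows "card (proper_colorings V E k) = k ^ card Y * card (proper_colorings (V - Y) E k)"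
proof -
  let ?F = "proper_colorings V E k" and ?H = "(Y \<rightarrow>\<^sub>E {..<k}) \<times> proper_colorings (V - Y) E k"
  have E: "a \<in> V" "a \<notin> Y" "b \<in> V" "b \<notin> Y" if "{a, b} \<in> E" for a b
    using simple_graphD(3)[OF assms(1) that] by auto
  have "bij_betw (\<lambda>f. (restrict f Y, restrict f (V - Y))) ?F ?H"
  proof (rule bij_betw_byWitness[where f' = "\<lambda>(g, h) x. if x \<in> Y then g x else h x"])
    show "\<forall>f\<in>?F. (\<lambda>(g, h) x. if x \<in> Y then g x else h x) (restrict f Y, restrict f (V - Y)) = f"
    proof (intro ballI ext)
      fix f x assume "f \<in> ?F"
      then have f: "f \<in> V \<rightarrow>\<^sub>E {..<k}"
        by (auto simp: proper_colorings_def)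
      show "(\<lambda>(g, h) x. if x \<in> Y then g x else h x) (restrict f Y, restrict f (V - Y)) x = f x"
        using PiE_arb[OF f, of x] by auto
    qed
    show "\<forall>gh\<in>?H. (restrict ((\<lambda>(g, h) x. if x \<in> Y then g x else h x) gh) Y,
        restrict ((\<lambda>(g, h) x. if x \<in> Y then g x else h x) gh) (V - Y)) = gh"
    proof clarify
      fix g h assume g: "g \<in> Y \<rightarrow>\<^sub>E {..<k}" and "h \<in> proper_colorings (V - Y) E k"
      then have h: "h \<in> (V - Y) \<rightarrow>\<^sub>E {..<k}"
        by (auto simp: proper_colorings_def)
      have "restrict (\<lambda>x. if x \<in> Y then g x else h x) Y = g"
        using PiE_arb[OF g] by (auto simp: fun_eq_iff)
      moreover have "restrict (\<lambda>x. if x \<in> Y then g x else h x) (V - Y) = h"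
        using PiE_arb[OF h] by (auto simp: fun_eq_iff)
      ultimately show "restrict (\<lambda>x. if x \<in> Y then g x else h x) Y = g \<and>
          restrict (\<lambda>x. if x \<in> Y then g x else h x) (V - Y) = h"
        by blast
    qed
    show "(\<lambda>f. (restrict f Y, restrict f (V - Y))) ` ?F \<subseteq> ?H"
      using assms(2) E by (auto simp: proper_colorings_def)
    show "(\<lambda>(g, h) x. if x \<in> Y then g x else h x) ` ?H \<subseteq> ?F"
    proof clarify
      fix g h assume g: "g \<in> Y \<rightarrow>\<^sub>E {..<k}" and h: "h \<in> proper_colorings (V - Y) E k"
      then have h': "h \<in> (V - Y) \<rightarrow>\<^sub>E {..<k}"
        by (auto simp: proper_colorings_def)
      have "(\<lambda>x. if x \<in> Y then g x else h x) \<in> V \<rightarrow>\<^sub>E {..<k}"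
      proof (rule PiE_I)
        fix x assume "x \<in> V"
        then show "(if x \<in> Y then g x else h x) \<in> {..<k}"
          using PiE_mem[OF g, of x] PiE_mem[OF h', of x] by simp
      next
        fix x assume "x \<notin> V"
        then show "(if x \<in> Y then g x else h x) = undefined"
          using PiE_arb[OF h', of x] assms(2) by auto
      qed
      then show "(\<lambda>x. if x \<in> Y then g x else h x) \<in> ?F"
        using h E by (auto simp: proper_colorings_def)
    qed
  qed
  then have "card ?F = card ?H"
    by (rule bij_betw_same_card)
  also have "\<dots> = k ^ card Y * card (proper_colorings (V - Y) E k)"
    using finite_subset[OF assms(2,3)] by (simp add: card_cartesian_product card_PiE)
  finally show ?thesis .
qed

lemma simple_graph_delete_vertices:
  "simple_graph V E \<Longrightarrow> simple_graph (V - Y) (delete_edges_at E Y)"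
  by (auto simp: simple_graph_def delete_edges_at_def)

text \<open>Keeping \<open>Y\<close> as isolated vertices multiplies the chromatic polynomial by
  \<open>\<lambda> ^ card Y\<close>, and Whitney numbers count from the top degree. All sets
  \<open>Y\<close> can therefore be compared on the fixed vertex set \<open>V\<close>.\<close>

lemma graph_whitney_delete_vertices:
  assumes "simple_graph V E" "Y \<subseteq> V"
  shows "graph_whitney (V - Y) (delete_edges_at E Y) j = graph_whitney V (delete_edges_at E Y) j"
proof -
  let ?E = "delete_edges_at E Y"
  have fin: "finite V" "finite Y"
    using simple_graphD(1)[OF assms(1)] assms(2) finite_subset by auto
  have sg: "simple_graph (V - Y) ?E"
    by (rule simple_graph_delete_vertices[OF assms(1)])
  have "chromatic_poly V ?E = monom 1 (card Y) * chromatic_poly (V - Y) ?E"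
    by (rule chromatic_poly_eqI)
      (simp add: poly_monom chromatic_poly_works(2)[OF sg]
        card_proper_colorings_isolated[OF sg assms(2) fin(1)])
  moreover have "card (V - Y) = card V - card Y" "card Y \<le> card V"
    using fin assms(2) by (auto simp: card_Diff_subset card_mono)
  ultimately show ?thesis
    by (auto simp: graph_whitney_eq coeff_monom_mult) (auto simp: algebra_simps)
qed

text \<open>A nonisolated vertex \<open>v \<in> Y\<close> becomes a component of its own, so the rank drops.\<close>

lemma graph_components_delete_less:
  assumes "simple_graph V E" "v \<in> Y" "v \<in> V" "v \<notin> isolated_vertices V E"
  shows "card (graph_components V E) < card (graph_components V (delete_edges_at E Y))"
proof -
  let ?F = "delete_edges_at E Y"
  obtain w where w: "{v, w} \<in> E" "w \<noteq> v" "w \<in> V"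
  proof -
    obtain e where "e \<in> E" "v \<in> e"
      using assms(3,4) by (auto simp: isolated_vertices_def)
    then show ?thesis
      using that simple_graph_edgeE[OF assms(1), of e] by (metis insert_commute insertE singletonD)
  qed
  \<comment> \<open>The indicator of \<open>v\<close> is constant along all remaining edges but not
    along \<open>{v, w}\<close>, so the set of constant maps grows strictly.\<close>
  let ?f = "\<lambda>x\<in>V. x = v"
  have sub: "?F \<subseteq> E"
    by (auto simp: delete_edges_at_def)
  have "edge_maps (=) V E (UNIV :: bool set) \<subseteq> edge_maps (=) V ?F (UNIV :: bool set)"
    using sub by (auto simp: edge_maps_def)
  moreover have "?f \<in> edge_maps (=) V ?F (UNIV :: bool set)"
  proof -
    have "?f a = ?f b" if "{a, b} \<in> ?F" for a b
      using that assms(2) simple_graphD(3)[OF assms(1), of a b] by (auto simp: delete_edges_at_def)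
    then show ?thesis
      by (auto simp: edge_maps_def)
  qed
  moreover have "?f \<notin> edge_maps (=) V E (UNIV :: bool set)"
  proof
    assume "?f \<in> edge_maps (=) V E (UNIV :: bool set)"
    then have "?f v = ?f w"
      using w(1) unfolding edge_maps_def by blast
    then show False
      using w assms(3) by simp
  qed
  ultimately have "card (edge_maps (=) V E (UNIV :: bool set)) < card (edge_maps (=) V ?F (UNIV :: bool set))"
    using simple_graphD(1)[OF assms(1)]
    by (intro psubset_card_mono finite_edge_maps) (auto simp: psubset_eq)
  then show ?thesis
    using card_constant_bool_maps[OF assms(1)]
      card_constant_bool_maps[OF simple_graph_subset[OF assms(1) sub]] by simp
qed

section \<open>Group expansions\<close>

lemma singleton_component:
  assumes "v \<in> V" "\<And>a b. (a, b) \<in> R \<Longrightarrow> a \<noteq> v \<and> b \<noteq> v"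
  shows "{v} \<in> components V R"
proof -
  have "w = v" if "(v, w) \<in> (R \<union> R\<inverse>)\<^sup>*" for w
    using that by (induction rule: rtrancl_induct) (use assms(2) in auto)
  then have "component_rel V R `` {v} = {v}"
    using assms(1) by auto
  then show ?thesis
    using component_of(1)[OF assms(1), of R] by simp
qed

lemma card_isolated_le_components:
  assumes "simple_graph V E"
  shows "card (isolated_vertices V E) \<le> card (graph_components V E)"
proof -
  have "(\<lambda>v. {v}) ` isolated_vertices V E \<subseteq> graph_components V E"
    unfolding graph_components_def
    by (auto simp: isolated_vertices_def intro!: singleton_component)
  then have "card ((\<lambda>v. {v}) ` isolated_vertices V E) \<le> card (graph_components V E)"
    using finite_components[OF simple_graphD(1)[OF assms]]
    by (intro card_mono) (auto simp: graph_components_def)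
  then show ?thesis
    by (simp add: card_image)
qed

text \<open>No lift and no half edge touches an isolated vertex outside \<open>X\<close>. Its
  singleton is thus a component with empty edge set, whatever \<open>S\<close> is.\<close>

lemma isolated_le_num_balanced:
  assumes "simple_graph V E" "orientation E ori" "S \<subseteq> edges (expansion G V E ori X)"
  shows "card (isolated_vertices V E - X) \<le> num_balanced G (expansion G V E ori X) S"
proof -
  let ?\<Phi> = "expansion G V E ori X" and ?I = "isolated_vertices V E - X"
  have ends: "fst (ori e) \<in> e" "snd (ori e) \<in> e" if "e \<in> E" for e
    using assms(2) that unfolding orientation_def by blast+
  have comp: "{v} \<in> spanning_components ?\<Phi> S" if "v \<in> ?I" for v
    unfolding spanning_components_def
    using that ends by (intro singleton_component) (auto simp: expansion_def isolated_vertices_def)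
  have empty: "{e \<in> S. src ?\<Phi> e \<in> {v}} = {}" if "v \<in> ?I" for v
  proof -
    have "src ?\<Phi> a \<noteq> v" if "a \<in> S" for a
      using \<open>v \<in> ?I\<close> ends subsetD[OF assms(3) that]
      by (cases a) (auto simp: expansion_def edges_def isolated_vertices_def)
    then show ?thesis
      by auto
  qed
  have "balanced G ?\<Phi> {}"
    by (auto simp: balanced_def circle_in_def)
  then have "(\<lambda>v. {v}) ` ?I \<subseteq>
      {W \<in> spanning_components ?\<Phi> S. balanced G ?\<Phi> {e \<in> S. src ?\<Phi> e \<in> W}}"
    using comp empty by (intro image_subsetI CollectI conjI) (blast, metis)
  moreover have "finite (spanning_components ?\<Phi> S)"
    using simple_graphD(1)[OF assms(1)]
    by (simp add: spanning_components_def finite_components expansion_def)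
  ultimately have "card ((\<lambda>v. {v}) ` ?I) \<le> num_balanced G ?\<Phi> S"
    unfolding num_balanced_def by (intro card_mono) auto
  then show ?thesis
    by (simp add: card_image)
qed

text \<open>Every monomial in the sum over edge sets has degree at least \<open>\<zeta>\<close>,
  while an index above \<open>n - \<zeta>\<close> refers to a lower power or exceeds
  \<open>n\<close>.\<close>

lemma gain_whitney_expansion_zero:
  assumes "simple_graph V E" "orientation E ori" "i > card V - card (isolated_vertices V E - X)"
  shows "gain_whitney G (expansion G V E ori X) i = 0"
proof -
  let ?\<Phi> = "expansion G V E ori X" and ?\<zeta> = "card (isolated_vertices V E - X)"
  have "coeff (gain_chromatic_poly G ?\<Phi>) d = 0" if "d < ?\<zeta>" for d
    unfolding gain_chromatic_poly_def coeff_sum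
  proof (intro sum.neutral ballI)
    fix S assume "S \<in> Pow (edges ?\<Phi>)"
    then have "d \<noteq> num_balanced G ?\<Phi> S"
      using isolated_le_num_balanced[OF assms(1,2), of S G X] that by auto
    then show "coeff (monom ((- 1) ^ card S :: int) (num_balanced G ?\<Phi> S)) d = 0"
      by simp
  qed
  moreover have "vertices ?\<Phi> = V"
    by (simp add: expansion_def)
  ultimately show ?thesis
    using assms(3) by (auto simp: gain_whitney_def signless_whitney_eq)
qed

section \<open>Colourings of an expansion\<close>

definition expansion_colours :: "('g, 'b) monoid_scheme \<Rightarrow> nat \<Rightarrow> ('g \<times> nat) option set" where
  "expansion_colours G k = insert None (Some ` (carrier G \<times> {..<k}))"

definition colour_action ::
  "('g, 'b) monoid_scheme \<Rightarrow> ('g \<times> nat) option \<Rightarrow> 'g \<Rightarrow> ('g \<times> nat) option" where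
  "colour_action G x g = map_option (\<lambda>(a, c). (a \<otimes>\<^bsub>G\<^esub> g, c)) x"

lemma card_expansion_colours:
  assumes "finite (carrier G)"
  shows "card (expansion_colours G k) = Coset.order G * k + 1"
  using assms by (simp add: expansion_colours_def card_insert_if card_image card_cartesian_product
      Coset.order_def)

lemma gain_colouring_expansion:
  assumes "simple_graph V E" "orientation E ori" "group G" "finite (carrier G)" "X \<subseteq> V"
  shows "gain_colouring G (expansion G V E ori X) (expansion_colours G k) None (colour_action G)"
proof -
  interpret group G
    by fact
  show ?thesis
  proof
    show "wf_gain_graph G (expansion G V E ori X)"
      by (rule wf_expansion[OF assms(1,2,4,5)])
    show "finite (expansion_colours G k)"
      using assms(4) by (simp add: expansion_colours_def)
    show "g = \<one>\<^bsub>G\<^esub>" if "x \<in> expansion_colours G k" "g \<in> carrier G"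
      "colour_action G x g = x" "x \<noteq> None" for x g
      using that by (auto simp: expansion_colours_def colour_action_def r_cancel_one')
  qed (auto simp: expansion_colours_def colour_action_def m_assoc)
qed

text \<open>The group component of a colour is irrelevant to propriety, because the lifts of an edge carry
  all gains.\<close>

lemma expansion_proper_iff:
  assumes "simple_graph V E" "orientation E ori" "group G" "finite (carrier G)" "X \<subseteq> V"
    and f: "f \<in> V \<rightarrow>\<^sub>E expansion_colours G k"
  shows "(\<forall>e\<in>edges (expansion G V E ori X).
      \<not> gain_colouring.improper (expansion G V E ori X) None (colour_action G) f e) \<longleftrightarrow>
    (\<forall>x\<in>X. f x \<noteq> None) \<and>
    (\<forall>a b. {a, b} \<in> E \<longrightarrow> map_option snd (f a) \<noteq> map_option snd (f b))"
proof -
  let ?\<Phi> = "expansion G V E ori X"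
  interpret gain_colouring G ?\<Phi> "expansion_colours G k" None "colour_action G"
    by (rule gain_colouring_expansion[OF assms(1-5)])
  \<comment> \<open>The orbits of the action are \<open>{None}\<close> and the copies of the group;
    within a copy, the inverse of \<open>a\<close> times \<open>b\<close> leads from
    \<open>a\<close> to \<open>b\<close>.\<close>
  have lift: "(\<exists>g\<in>carrier G. q = colour_action G p g) \<longleftrightarrow> map_option snd p = map_option snd q"
    if "p \<in> expansion_colours G k" "q \<in> expansion_colours G k" for p q
  proof
    assume "\<exists>g\<in>carrier G. q = colour_action G p g"
    then show "map_option snd p = map_option snd q"
      by (cases p) (auto simp: colour_action_def)
  next
    assume eq: "map_option snd p = map_option snd q"
    show "\<exists>g\<in>carrier G. q = colour_action G p g"
    proof (cases p)
      case None
      then show ?thesis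
        using eq by (auto simp: colour_action_def)
    next
      case (Some ac)
      then obtain a b c where pq: "p = Some (a, c)" "q = Some (b, c)"
        using eq by (cases ac; cases q) auto
      then have "a \<in> carrier G" "b \<in> carrier G"
        using that by (auto simp: expansion_colours_def)
      then have "inv\<^bsub>G\<^esub> a \<otimes>\<^bsub>G\<^esub> b \<in> carrier G" "a \<otimes>\<^bsub>G\<^esub> (inv\<^bsub>G\<^esub> a \<otimes>\<^bsub>G\<^esub> b) = b"
        by (simp_all add: m_assoc[symmetric])
      then show ?thesis
        using pq by (force simp: colour_action_def)
    qed
  qed
  have half: "improper f (Half x) \<longleftrightarrow> f x = None" if "x \<in> X" for x
    unfolding improper_def using that by (simp add: expansion_def)
  have ordinary: "improper f (Lift g e) \<longleftrightarrow> f (snd (ori e)) = colour_action G (f (fst (ori e))) g"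
    for g e
    unfolding improper_def by (auto simp: expansion_def)
  have ori: "{fst (ori e), snd (ori e)} = e" if "e \<in> E" for e
    using assms(2) that by (auto simp: orientation_def)
  have fK: "f a \<in> expansion_colours G k" if "a \<in> V" for a
    using f that by auto
  have "(\<forall>e\<in>edges ?\<Phi>. \<not> improper f e) \<longleftrightarrow>
      (\<forall>x\<in>X. \<not> improper f (Half x)) \<and> (\<forall>e\<in>E. \<forall>g\<in>carrier G. \<not> improper f (Lift g e))"
    by (auto simp: edges_def expansion_def)
  also have "\<dots> \<longleftrightarrow> (\<forall>x\<in>X. f x \<noteq> None) \<and>
      (\<forall>e\<in>E. map_option snd (f (fst (ori e))) \<noteq> map_option snd (f (snd (ori e))))"
  proof -
    have "(\<forall>g\<in>carrier G. \<not> improper f (Lift g e)) \<longleftrightarrow>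
        map_option snd (f (fst (ori e))) \<noteq> map_option snd (f (snd (ori e)))" if "e \<in> E" for e
    proof -
      have "fst (ori e) \<in> V" "snd (ori e) \<in> V"
        using simple_graphD(3)[OF assms(1), of "fst (ori e)" "snd (ori e)"] ori[OF that] that by auto
      then show ?thesis
        using lift[OF fK fK] unfolding ordinary by blast
    qed
    then show ?thesis
      using half by auto
  qed
  also have "(\<forall>e\<in>E. map_option snd (f (fst (ori e))) \<noteq> map_option snd (f (snd (ori e)))) \<longleftrightarrow>
      (\<forall>a b. {a, b} \<in> E \<longrightarrow> map_option snd (f a) \<noteq> map_option snd (f b))"
  proof
    assume *: "\<forall>e\<in>E. map_option snd (f (fst (ori e))) \<noteq> map_option snd (f (snd (ori e)))"
    show "\<forall>a b. {a, b} \<in> E \<longrightarrow> map_option snd (f a) \<noteq> map_option snd (f b)"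
    proof (intro allI impI)
      fix a b assume ab: "{a, b} \<in> E"
      then show "map_option snd (f a) \<noteq> map_option snd (f b)"
        using bspec[OF * ab] ori[OF ab] by (auto simp: doubleton_eq_iff)
    qed
  next
    assume *: "\<forall>a b. {a, b} \<in> E \<longrightarrow> map_option snd (f a) \<noteq> map_option snd (f b)"
    show "\<forall>e\<in>E. map_option snd (f (fst (ori e))) \<noteq> map_option snd (f (snd (ori e)))"
      using * ori by metis
  qed
  finally show ?thesis .
qed

definition stable_sets :: "'v set \<Rightarrow> 'v set set \<Rightarrow> 'v set \<Rightarrow> 'v set set" where
  "stable_sets V E X = {Y. Y \<subseteq> V - X \<and> stable E Y}"

lemma finite_stable_sets: "finite V \<Longrightarrow> finite (stable_sets V E X)"
  by (rule finite_subset[of _ "Pow V"]) (auto simp: stable_sets_def)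

text \<open>Outside \<open>Y\<close> a colour is a pair: a group element, which is unconstrained,
  and the index of a copy. The indices must form a proper colouring of what is left after deleting
  \<open>Y\<close>.\<close>

lemma card_expansion_proper_fiber:
  assumes "simple_graph V E" "finite (carrier G)" "X \<subseteq> V" "Y \<in> stable_sets V E X"
  shows "card {f \<in> V \<rightarrow>\<^sub>E expansion_colours G k. ((\<forall>x\<in>X. f x \<noteq> None) \<and>
      (\<forall>a b. {a, b} \<in> E \<longrightarrow> map_option snd (f a) \<noteq> map_option snd (f b))) \<and>
      {v \<in> V. f v = None} = Y} =
    Coset.order G ^ card (V - Y) * card (proper_colorings (V - Y) (delete_edges_at E Y) k)"
    (is "card ?F = _")
proof -
  let ?E = "delete_edges_at E Y" and ?K = "expansion_colours G k"
  let ?H = "((V - Y) \<rightarrow>\<^sub>E carrier G) \<times> proper_colorings (V - Y) ?E k"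
  let ?to = "\<lambda>f. (\<lambda>v\<in>V - Y. fst (the (f v)), \<lambda>v\<in>V - Y. snd (the (f v)))"
  let ?from = "\<lambda>(g, h). \<lambda>v\<in>V. if v \<in> Y then None else Some (g v, h v)"
  have Y: "Y \<subseteq> V" "Y \<inter> X = {}" and stab: "\<And>e. e \<in> E \<Longrightarrow> \<not> e \<subseteq> Y"
    using assms(4) by (auto simp: stable_sets_def stable_def)
  note E = simple_graphD(3)[OF assms(1)]
  have some: "\<exists>a c. f v = Some (a, c) \<and> a \<in> carrier G \<and> c < k" if "f \<in> ?F" "v \<in> V - Y" for f v
  proof -
    have "f v \<in> ?K" "f v \<noteq> None"
      using that by auto
    then show ?thesis
      by (auto simp: expansion_colours_def)
  qed
  have "bij_betw ?to ?F ?H"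
  proof (rule bij_betw_byWitness[where f' = ?from])
    show "\<forall>f\<in>?F. ?from (?to f) = f"
    proof (intro ballI ext)
      fix f v assume f: "f \<in> ?F"
      then have fE: "f \<in> V \<rightarrow>\<^sub>E ?K" and fY: "v \<in> Y \<Longrightarrow> f v = None"
        by blast+
      consider "v \<notin> V" | "v \<in> Y" | "v \<in> V - Y"
        by blast
      then show "?from (?to f) v = f v"
      proof cases
        case 1
        then show ?thesis
          using PiE_arb[OF fE 1] by simp
      next
        case 2
        then show ?thesis
          using fY Y by auto
      next
        case 3
        then show ?thesis
          using some[OF f 3] by auto
      qed
    qed
    show "\<forall>gh\<in>?H. ?to (?from gh) = gh"
    proof
      fix gh assume "gh \<in> ?H"
      then obtain g h where gh: "gh = (g, h)" and g: "g \<in> (V - Y) \<rightarrow>\<^sub>E carrier G"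
        and h: "h \<in> (V - Y) \<rightarrow>\<^sub>E {..<k}"
        by (auto simp: proper_colorings_def)
      have "fst (?to (?from (g, h))) = g"
        using PiE_arb[OF g] by (auto simp: fun_eq_iff)
      moreover have "snd (?to (?from (g, h))) = h"
        using PiE_arb[OF h] by (auto simp: fun_eq_iff)
      ultimately show "?to (?from gh) = gh"
        unfolding gh by (simp only: fst_conv snd_conv)
    qed
    show "?to ` ?F \<subseteq> ?H"
    proof (rule image_subsetI)
      fix f assume f: "f \<in> ?F"
      have "fst (the (f v)) \<in> carrier G" "snd (the (f v)) \<in> {..<k}" if "v \<in> V - Y" for v
        using some[OF f that] by auto
      then have "(\<lambda>v\<in>V - Y. fst (the (f v))) \<in> (V - Y) \<rightarrow>\<^sub>E carrier G"
        "(\<lambda>v\<in>V - Y. snd (the (f v))) \<in> (V - Y) \<rightarrow>\<^sub>E {..<k}"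
        by (simp_all only: restrict_PiE_iff) blast+
      moreover have "snd (the (f a)) \<noteq> snd (the (f b))" "a \<in> V - Y" "b \<in> V - Y"
        if "{a, b} \<in> ?E" for a b
      proof -
        have ab: "{a, b} \<in> E" and a: "a \<in> V - Y" and b: "b \<in> V - Y"
          using that E[of a b] by (auto simp: delete_edges_at_def)
        then show "a \<in> V - Y" "b \<in> V - Y"
          by blast+
        have "map_option snd (f a) \<noteq> map_option snd (f b)"
          using f ab by blast
        then show "snd (the (f a)) \<noteq> snd (the (f b))"
          using some[OF f a] some[OF f b] by auto
      qed
      ultimately show "?to f \<in> ?H"
        by (simp add: proper_colorings_def)
    qed
    show "?from ` ?H \<subseteq> ?F"
    proof (rule image_subsetI)
      fix gh assume "gh \<in> ?H"
      then obtain g h where gh: "gh = (g, h)" and g: "g \<in> (V - Y) \<rightarrow>\<^sub>E carrier G"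
        and h: "h \<in> (V - Y) \<rightarrow>\<^sub>E {..<k}" and proper: "\<And>a b. {a, b} \<in> ?E \<Longrightarrow> h a \<noteq> h b"
        by (auto simp: proper_colorings_def)
      let ?f = "\<lambda>v\<in>V. if v \<in> Y then None else Some (g v, h v)"
      have "?f \<in> V \<rightarrow>\<^sub>E ?K"
        using PiE_mem[OF g] PiE_mem[OF h] by (auto simp: expansion_colours_def)
      moreover have "\<forall>x\<in>X. ?f x \<noteq> None"
        using Y assms(3) by auto
      moreover have "map_option snd (?f a) \<noteq> map_option snd (?f b)" if ab: "{a, b} \<in> E" for a b
      proof -
        have V: "a \<in> V" "b \<in> V"
          using E[OF ab] by auto
        \<comment> \<open>Stability excludes an edge inside \<open>Y\<close>. With one end in
          \<open>Y\<close> the colours differ as \<open>None\<close> and \<open>Some\<close>; with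
          none, the edge survives the deletion.\<close>
        have "\<not> (a \<in> Y \<and> b \<in> Y)"
          using stab[OF ab] by auto
        moreover have "h a \<noteq> h b" if "a \<notin> Y" "b \<notin> Y"
          using proper[of a b] that ab by (auto simp: delete_edges_at_def)
        ultimately show ?thesis
          using V by auto
      qed
      moreover have "{v \<in> V. ?f v = None} = Y"
        using Y by auto
      ultimately show "?from gh \<in> ?F"
        unfolding gh by auto
    qed
  qed
  then have "card ?F = card ?H"
    by (rule bij_betw_same_card)
  then show ?thesis
    using simple_graphD(1)[OF assms(1)]
    by (simp add: card_cartesian_product card_PiE Coset.order_def)
qed

lemma poly_gain_chromatic_poly_expansion:
  assumes "simple_graph V E" "orientation E ori" "group G" "finite (carrier G)" "X \<subseteq> V"
  shows "poly (gain_chromatic_poly G (expansion G V E ori X)) (int (Coset.order G) * int k + 1) =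
    (\<Sum>Y\<in>stable_sets V E X. int (Coset.order G) ^ card (V - Y) *
      poly (chromatic_poly (V - Y) (delete_edges_at E Y)) (int k))"
proof -
  let ?\<Phi> = "expansion G V E ori X" and ?K = "expansion_colours G k"
  interpret gain_colouring G ?\<Phi> ?K None "colour_action G"
    by (rule gain_colouring_expansion[OF assms])
  let ?Q = "\<lambda>f. (\<forall>x\<in>X. f x \<noteq> None) \<and>
    (\<forall>a b. {a, b} \<in> E \<longrightarrow> map_option snd (f a) \<noteq> map_option snd (f b))"
  let ?P = "{f \<in> V \<rightarrow>\<^sub>E ?K. ?Q f}"
  have fin: "finite V" "finite (V \<rightarrow>\<^sub>E ?K)"
    using simple_graphD(1)[OF assms(1)] finite_K by (auto intro: finite_PiE)
  \<comment> \<open>Two ends of colour \<open>None\<close> would agree, so the vertices of colour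
    zero span no edge; the half edges keep them out of \<open>X\<close>.\<close>
  have stab: "{v \<in> V. f v = None} \<in> stable_sets V E X" if "?Q f" for f
  proof -
    have "\<not> e \<subseteq> {v \<in> V. f v = None}" if e: "e \<in> E" for e
    proof -
      obtain a b where "e = {a, b}"
        using simple_graph_edgeE[OF assms(1) e] .
      then show ?thesis
        using \<open>?Q f\<close> e by force
    qed
    then show ?thesis
      using that by (auto simp: stable_sets_def stable_def)
  qed
  have "poly (gain_chromatic_poly G ?\<Phi>) (int (Coset.order G) * int k + 1) =
      int (card {f \<in> V \<rightarrow>\<^sub>E ?K. \<forall>e\<in>edges ?\<Phi>. \<not> improper f e})"
  proof -
    have vertices: "vertices ?\<Phi> = V"
      by (simp add: expansion_def)
    have colours: "int (card ?K) = int (Coset.order G) * int k + 1"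
      by (simp add: card_expansion_colours[OF assms(4)])
    show ?thesis
      using gain_chromatic_poly_counts unfolding vertices colours .
  qed
  also have "{f \<in> V \<rightarrow>\<^sub>E ?K. \<forall>e\<in>edges ?\<Phi>. \<not> improper f e} = ?P"
    using expansion_proper_iff[OF assms] by blast
  also have "?P = (\<Union>Y\<in>stable_sets V E X. {f \<in> V \<rightarrow>\<^sub>E ?K. ?Q f \<and> {v \<in> V. f v = None} = Y})"
    using stab by blast
  also have "card \<dots> =
      (\<Sum>Y\<in>stable_sets V E X. card {f \<in> V \<rightarrow>\<^sub>E ?K. ?Q f \<and> {v \<in> V. f v = None} = Y})"
    using fin by (intro card_UN_disjoint ballI) (auto simp: finite_stable_sets)
  also have "\<dots> = (\<Sum>Y\<in>stable_sets V E X.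
      Coset.order G ^ card (V - Y) * card (proper_colorings (V - Y) (delete_edges_at E Y) k))"
    by (intro sum.cong refl card_expansion_proper_fiber[OF assms(1,4,5)])
  finally show ?thesis
    by (simp add: chromatic_poly_works(2)[OF simple_graph_delete_vertices[OF assms(1)]])
qed

section \<open>Coefficients\<close>

text \<open>Separating the sets \<open>Y\<close> that contain \<open>x\<close> expresses the sum as
  a difference of two instances for \<open>I\<close>, at \<open>c\<close> and at
  \<open>c - 1\<close>; Pascal's rule evaluates it.\<close>

lemma alternating_subset_binomial_sum:
  assumes "finite I" "card I \<le> c" "card I \<le> m"
  shows "(\<Sum>Y\<in>Pow I. (- 1) ^ card Y * int ((c - card Y) choose m)) =
    int ((c - card I) choose (m - card I))"
  using assms
proof (induction I arbitrary: c rule: finite_induct)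
  case (insert x I)
  \<comment> \<open>Written with successors, so that no subtraction is truncated and Pascal's rule
    applies directly.\<close>
  then obtain a b where ab: "c = card I + Suc a" "m = card I + Suc b"
    by (metis Suc_le_eq card_insert_disjoint le_Suc_ex add_Suc_shift add_Suc)
  have fin: "finite Y" "x \<notin> Y" if "Y \<in> Pow I" for Y
    using that insert.hyps finite_subset by auto
  have "(\<Sum>Y\<in>Pow (insert x I). (- 1) ^ card Y * int ((c - card Y) choose m)) =
      (\<Sum>Y\<in>Pow I. (- 1) ^ card Y * int ((c - card Y) choose m)) +
      (\<Sum>Y\<in>insert x ` Pow I. (- 1) ^ card Y * int ((c - card Y) choose m))"
    unfolding Pow_insert using insert.hyps by (intro sum.union_disjoint) auto
  also have "(\<Sum>Y\<in>insert x ` Pow I. (- 1) ^ card Y * int ((c - card Y) choose m)) =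
      (\<Sum>Y\<in>Pow I. (- 1) ^ card (insert x Y) * int ((c - card (insert x Y)) choose m))"
    using insert.hyps by (intro sum.reindex_cong[of "insert x"]) (auto simp: inj_on_def)
  also have "\<dots> = - (\<Sum>Y\<in>Pow I. (- 1) ^ card Y * int ((c - 1 - card Y) choose m))"
    unfolding sum_negf[symmetric] using fin by (intro sum.cong) simp_all
  also have "(\<Sum>Y\<in>Pow I. (- 1) ^ card Y * int ((c - 1 - card Y) choose m)) =
      int ((c - 1 - card I) choose (m - card I))"
    by (rule insert.IH) (simp_all add: ab)
  also have "(\<Sum>Y\<in>Pow I. (- 1) ^ card Y * int ((c - card Y) choose m)) =
      int ((c - card I) choose (m - card I))"
    by (rule insert.IH) (simp_all add: ab)
  finally show ?case
    using insert.hyps by (simp add: ab)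
qed simp

abbreviation (input) deleted_whitney :: "'v set \<Rightarrow> 'v set set \<Rightarrow> 'v set \<Rightarrow> nat \<Rightarrow> int" where
  "deleted_whitney V E Y j \<equiv> graph_whitney (V - Y) (delete_edges_at E Y) j"

text \<open>\<open>[:- 1, 1:]\<close> is \<open>\<lambda> - 1\<close>. The factor
  \<open>\<gamma> ^ card (V - Y)\<close> clears the denominators of
  \<open>(\<lambda> - 1) / \<gamma>\<close> and leaves \<open>\<gamma> ^ j\<close>, so the identity
  holds over the integers.\<close>

lemma gain_chromatic_poly_expansion:
  assumes "simple_graph V E" "orientation E ori" "group G" "finite (carrier G)" "X \<subseteq> V"
  shows "gain_chromatic_poly G (expansion G V E ori X) =
    (\<Sum>Y\<in>stable_sets V E X. \<Sum>j=0..card (V - Y).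
      smult ((- 1) ^ j * deleted_whitney V E Y j * int (Coset.order G) ^ j)
        ([:- 1, 1:] ^ (card (V - Y) - j)))" (is "?p = ?q")
proof (rule poly_eq_on_infinite)
  let ?\<gamma> = "int (Coset.order G)"
  interpret group G
    by fact
  \<comment> \<open>A positive group order makes the evaluation points \<open>\<gamma> k + 1\<close>
    distinct.\<close>
  have "Coset.order G > 0"
    using assms(4) by (simp add: order_gt_0_iff_finite)
  then have "inj (\<lambda>k. ?\<gamma> * int k + 1)"
    by (auto simp: inj_on_def)
  then show "infinite (range (\<lambda>k. ?\<gamma> * int k + 1))"
    by (rule range_inj_infinite)
  fix x assume "x \<in> range (\<lambda>k. ?\<gamma> * int k + 1)"
  then obtain k where x: "x = ?\<gamma> * int k + 1"
    by blast
  have "poly ?p x = (\<Sum>Y\<in>stable_sets V E X. ?\<gamma> ^ card (V - Y) * (\<Sum>j=0..card (V - Y).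
      (- 1) ^ j * deleted_whitney V E Y j * int k ^ (card (V - Y) - j)))"
    unfolding x poly_gain_chromatic_poly_expansion[OF assms]
    by (simp only: poly_chromatic_poly[OF simple_graph_delete_vertices[OF assms(1)]])
  also have "\<dots> = (\<Sum>Y\<in>stable_sets V E X. \<Sum>j=0..card (V - Y).
      (- 1) ^ j * deleted_whitney V E Y j * ?\<gamma> ^ j * (?\<gamma> * int k) ^ (card (V - Y) - j))"
    unfolding sum_distrib_left
  proof (intro sum.cong refl)
    fix Y j assume "j \<in> {0..card (V - Y)}"
    then have "?\<gamma> ^ card (V - Y) = ?\<gamma> ^ j * ?\<gamma> ^ (card (V - Y) - j)"
      by (simp flip: power_add)
    then show "?\<gamma> ^ card (V - Y) *
        ((- 1) ^ j * deleted_whitney V E Y j * int k ^ (card (V - Y) - j)) =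
        (- 1) ^ j * deleted_whitney V E Y j * ?\<gamma> ^ j * (?\<gamma> * int k) ^ (card (V - Y) - j)"
      by (simp add: power_mult_distrib)
  qed
  also have "\<dots> = poly ?q x"
    by (simp add: poly_sum x)
  finally show "poly ?p x = poly ?q x" .
qed

text \<open>Reads off the coefficient of \<open>\<lambda> ^ (n - i)\<close> in powers of
  \<open>\<lambda> - 1\<close>. The guard keeps the range \<open>k \<le> i - j\<close> of the final
  formula, which then results from grouping by \<open>k = card Y\<close>.\<close>

lemma gain_whitney_expansion_double_sum:
  assumes "simple_graph V E" "orientation E ori" "group G" "finite (carrier G)" "X \<subseteq> V"
    and i: "i \<le> card V"
  shows "gain_whitney G (expansion G V E ori X) i =
    (\<Sum>Y\<in>stable_sets V E X. \<Sum>j=0..i. if card Y \<le> i - j then int (Coset.order G) ^ j *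
      ((- 1) ^ card Y * int ((card V - j - card Y) choose (card V - i)) * deleted_whitney V E Y j)
      else 0)"
proof -
  let ?n = "card V" and ?\<gamma> = "int (Coset.order G)"
  let ?t = "\<lambda>Y j. if card Y \<le> i - j then ?\<gamma> ^ j *
    ((- 1) ^ card Y * int ((?n - j - card Y) choose (?n - i)) * deleted_whitney V E Y j) else 0"
  have "vertices (expansion G V E ori X) = V"
    by (simp add: expansion_def)
  then have "gain_whitney G (expansion G V E ori X) i =
      (\<Sum>Y\<in>stable_sets V E X. \<Sum>j=0..card (V - Y). (- 1) ^ i *
        ((- 1) ^ j * deleted_whitney V E Y j * ?\<gamma> ^ j *
          coeff ([:- 1, 1:] ^ (card (V - Y) - j)) (?n - i)))"
    using i by (simp add: gain_whitney_def signless_whitney_eq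
        gain_chromatic_poly_expansion[OF assms(1-5)] coeff_sum sum_distrib_left)
  also have "\<dots> = (\<Sum>Y\<in>stable_sets V E X. \<Sum>j=0..i. ?t Y j)"
  proof (rule sum.cong[OF refl])
    fix Y assume "Y \<in> stable_sets V E X"
    then have "Y \<subseteq> V"
      by (auto simp: stable_sets_def)
    then have Y: "card (V - Y) = ?n - card Y" "card Y \<le> ?n"
      using simple_graphD(1)[OF assms(1)] finite_subset[of Y V]
      by (auto simp: card_Diff_subset card_mono)
    let ?s = "\<lambda>j. (- 1) ^ i * ((- 1) ^ j * deleted_whitney V E Y j * ?\<gamma> ^ j *
      coeff ([:- 1, 1:] ^ (card (V - Y) - j)) (?n - i))"
    have term_eq: "?s j = (if card Y + j \<le> i then ?t Y j else 0)" if "j \<le> ?n - card Y" for j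
    proof (cases "card Y + j \<le> i")
      case True
      then have le: "?n - i \<le> ?n - card Y - j"
        by simp
      \<comment> \<open>The exponents add up to \<open>2 * i - card Y\<close>, which has the parity
        of \<open>card Y\<close>.\<close>
      have sign: "(- 1 :: int) ^ i * (- 1) ^ j * (- 1) ^ (?n - card Y - j - (?n - i)) = (- 1) ^ card Y"
      proof -
        have "i + j + (?n - card Y - j - (?n - i)) = card Y + 2 * (i - card Y)"
          using True i by simp
        then show ?thesis
          by (metis power_add power_minus1_even mult.right_neutral)
      qed
      have "?s j = ((- 1) ^ i * (- 1) ^ j * (- 1) ^ (?n - card Y - j - (?n - i))) *
          (deleted_whitney V E Y j * ?\<gamma> ^ j * int ((?n - card Y - j) choose (?n - i)))"
        unfolding Y(1) coeff_linear_poly_power[OF le] by simp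
      also have "\<dots> = ?t Y j"
        unfolding sign using add_le_imp_le_diff[OF True] by (simp add: add.commute)
      finally show ?thesis
        using True by simp
    next
      case False
      \<comment> \<open>For \<open>card Y + j > i\<close> the power of \<open>\<lambda> - 1\<close>
        has degree below \<open>n - i\<close>.\<close>
      then have "degree ([:- 1, 1:] ^ (?n - card Y - j) :: int poly) < ?n - i"
        using i Y that by (simp add: degree_linear_power)
      then show ?thesis
        using False Y by (simp add: coeff_eq_0)
    qed
    have "(\<Sum>j=0..card (V - Y). ?s j) =
        (\<Sum>j=0..?n - card Y. if card Y + j \<le> i then ?t Y j else 0)"
      unfolding Y(1)[symmetric] using term_eq Y(1) by (intro sum.cong) auto
    \<comment> \<open>This set lies in both ranges, \<open>0..n - card Y\<close> (by
      \<open>i \<le> n\<close>) and \<open>0..i\<close>, and the terms outside it vanish.\<close>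
    also have "\<dots> = (\<Sum>j\<in>{j. card Y + j \<le> i}. ?t Y j)"
      using i Y by (intro sum.mono_neutral_cong_right) auto
    also have "\<dots> = (\<Sum>j=0..i. ?t Y j)"
      by (intro sum.mono_neutral_left) auto
    finally show "(\<Sum>j=0..card (V - Y). ?s j) = (\<Sum>j=0..i. ?t Y j)" .
  qed
  finally show ?thesis .
qed

lemma expansion_coefficient_eq:
  assumes "finite V"
  shows "(\<Sum>k=0..i - j. (- 1) ^ k * int ((card V - j - k) choose (card V - i)) *
      (\<Sum>Y | Y \<subseteq> V - X \<and> stable E Y \<and> card Y = k. deleted_whitney V E Y j)) =
    (\<Sum>Y\<in>{Y \<in> stable_sets V E X. card Y \<le> i - j}. (- 1) ^ card Y *
      int ((card V - j - card Y) choose (card V - i)) * deleted_whitney V E Y j)"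
proof -
  let ?S = "{Y \<in> stable_sets V E X. card Y \<le> i - j}"
  let ?h = "\<lambda>Y. (- 1) ^ card Y * int ((card V - j - card Y) choose (card V - i)) *
    deleted_whitney V E Y j"
  have "(\<Sum>k=0..i - j. (- 1) ^ k * int ((card V - j - k) choose (card V - i)) *
      (\<Sum>Y | Y \<subseteq> V - X \<and> stable E Y \<and> card Y = k. deleted_whitney V E Y j)) =
      (\<Sum>k=0..i - j. \<Sum>Y\<in>{Y \<in> ?S. card Y = k}. ?h Y)"
    unfolding sum_distrib_left by (intro sum.cong) (auto simp: stable_sets_def)
  also have "\<dots> = (\<Sum>Y\<in>?S. ?h Y)"
    using finite_stable_sets[OF assms, of E X] by (intro sum.group) auto
  finally show ?thesis .
qed

lemma gain_whitney_expansion: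
  assumes "simple_graph V E" "orientation E ori" "group G" "finite (carrier G)" "X \<subseteq> V"
    and "i \<le> card V"
  shows "gain_whitney G (expansion G V E ori X) i =
    (\<Sum>j=0..i. int (Coset.order G) ^ j *
      (\<Sum>k=0..i - j. (- 1) ^ k * int ((card V - j - k) choose (card V - i)) *
        (\<Sum>Y | Y \<subseteq> V - X \<and> stable E Y \<and> card Y = k. deleted_whitney V E Y j)))"
proof -
  have V: "finite V"
    by (rule simple_graphD(1)[OF assms(1)])
  show ?thesis
    unfolding gain_whitney_expansion_double_sum[OF assms] expansion_coefficient_eq[OF V]
    by (subst sum.swap)
      (simp only: sum_distrib_left, simp only: sum.inter_filter[OF finite_stable_sets[OF V]])
qed

section \<open>Degree and leading coefficient\<close>

lemma coeff_expansion_whitney_poly: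
  assumes "finite V"
  shows "coeff (expansion_whitney_poly V E X i) j = (if j \<le> i then
    (\<Sum>Y\<in>{Y \<in> stable_sets V E X. card Y \<le> i - j}. (- 1) ^ card Y *
      int ((card V - j - card Y) choose (card V - i)) * deleted_whitney V E Y j) else 0)"
  unfolding expansion_whitney_poly_def coeff_sum expansion_coefficient_eq[OF assms] coeff_monom
  by simp

text \<open>At \<open>j = i\<close> the size bound leaves only the empty set, and its binomial
  coefficient is 1.\<close>

lemma coeff_expansion_whitney_poly_diagonal:
  assumes "simple_graph V E"
  shows "coeff (expansion_whitney_poly V E X i) i = graph_whitney V E i"
proof -
  have "stable E {}"
    using assms by (auto simp: stable_def simple_graph_def)
  then have "{Y \<in> stable_sets V E X. card Y \<le> i - i} = {{}}"
    using simple_graphD(1)[OF assms] by (auto simp: stable_sets_def dest: finite_subset)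
  moreover have "delete_edges_at E {} = E"
    by (auto simp: delete_edges_at_def)
  ultimately show ?thesis
    by (simp add: coeff_expansion_whitney_poly[OF simple_graphD(1)[OF assms]])
qed

text \<open>Deleting edges cannot decrease the number of components, so it cannot raise the
  rank.\<close>

lemma deleted_whitney_zero:
  assumes "simple_graph V E" "Y \<subseteq> V" "j > card V - card (graph_components V E)"
  shows "deleted_whitney V E Y j = 0"
proof -
  have sub: "delete_edges_at E Y \<subseteq> E"
    by (auto simp: delete_edges_at_def)
  then have "graph_whitney V (delete_edges_at E Y) j = 0"
    using graph_components_antimono[OF assms(1) sub] assms(3)
    by (intro graph_whitney_zero simple_graph_subset[OF assms(1)]) auto
  then show ?thesis
    by (simp add: graph_whitney_delete_vertices[OF assms(1,2)])
qed

lemma coeff_expansion_whitney_poly_zero: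
  assumes "simple_graph V E" "j > card V - card (graph_components V E)"
  shows "coeff (expansion_whitney_poly V E X i) j = 0"
proof -
  have "deleted_whitney V E Y j = 0" if "Y \<in> stable_sets V E X" for Y
    using that by (intro deleted_whitney_zero[OF assms(1) _ assms(2)]) (auto simp: stable_sets_def)
  then show ?thesis
    unfolding coeff_expansion_whitney_poly[OF simple_graphD(1)[OF assms(1)]]
    by (simp add: sum.neutral)
qed

text \<open>Only sets \<open>Y\<close> of isolated vertices leave the rank unchanged, and these contribute an
  alternating sum of binomial coefficients.\<close>

lemma coeff_expansion_whitney_poly_rank:
  fixes V X :: "'v set" and E :: "'v set set"
  defines "c \<equiv> card (graph_components V E)" and "\<zeta> \<equiv> card (isolated_vertices V E - X)"
  assumes sg: "simple_graph V E" and i: "i \<le> card V - \<zeta>" "card V - c \<le> i"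
  shows "coeff (expansion_whitney_poly V E X i) (card V - c) =
    graph_whitney V E (card V - c) * int ((c - \<zeta>) choose (i - (card V - c)))"
proof -
  let ?n = "card V" and ?I = "isolated_vertices V E - X"
  let ?r = "?n - c"
  let ?m = "?n - i"
  let ?S = "{Y \<in> stable_sets V E X. card Y \<le> i - ?r}"
  let ?h = "\<lambda>Y. (- 1) ^ card Y * int ((?n - ?r - card Y) choose ?m) * deleted_whitney V E Y ?r"
  have V: "finite V"
    by (rule simple_graphD(1)[OF sg])
  have IV: "?I \<subseteq> V"
    by (auto simp: isolated_vertices_def)
  then have I: "finite ?I"
    using V finite_subset by blast
  have cn: "c \<le> ?n"
    unfolding c_def by (rule graph_components_le[OF sg])
  have "\<zeta> \<le> card (isolated_vertices V E)"
    unfolding \<zeta>_def using V by (intro card_mono) (auto simp: isolated_vertices_def)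
  then have \<zeta>c: "\<zeta> \<le> c"
    using card_isolated_le_components[OF sg] by (simp add: c_def)
  have m: "\<zeta> \<le> ?m" "?m \<le> c"
    using i \<zeta>c cn by linarith+
  \<comment> \<open>As \<open>Y\<close> avoids \<open>X\<close>, a member outside \<open>?I\<close>
    is nonisolated, and its deletion pushes the rank below \<open>?r\<close>.\<close>
  have drop: "deleted_whitney V E Y ?r = 0" if Y: "Y \<subseteq> V - X" "\<not> Y \<subseteq> ?I" for Y
  proof -
    obtain v where v: "v \<in> Y" "v \<in> V" "v \<notin> isolated_vertices V E"
      using Y by blast
    have sg': "simple_graph V (delete_edges_at E Y)"
      by (rule simple_graph_subset[OF sg]) (auto simp: delete_edges_at_def)
    have "?n - card (graph_components V (delete_edges_at E Y)) < ?r"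
      using graph_components_delete_less[OF sg v] graph_components_le[OF sg']
      unfolding c_def by linarith
    then have "graph_whitney V (delete_edges_at E Y) ?r = 0"
      by (rule graph_whitney_zero[OF sg'])
    moreover have "Y \<subseteq> V"
      using Y(1) by blast
    ultimately show ?thesis
      by (simp only: graph_whitney_delete_vertices[OF sg])
  qed
  have keep: "deleted_whitney V E Y ?r = graph_whitney V E ?r" if "Y \<subseteq> ?I" for Y
  proof -
    have "delete_edges_at E Y = E"
      using that by (auto simp: delete_edges_at_def isolated_vertices_def)
    then show ?thesis
      using graph_whitney_delete_vertices[OF sg, of Y ?r] that IV by auto
  qed
  have stab: "Y \<in> stable_sets V E X" if "Y \<subseteq> ?I" for Y
  proof -
    have "\<not> e \<subseteq> Y" if e: "e \<in> E" for e
    proof -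
      obtain a b where "e = {a, b}"
        using simple_graph_edgeE[OF sg e] .
      then show ?thesis
        using e \<open>Y \<subseteq> ?I\<close> by (auto simp: isolated_vertices_def)
    qed
    then show ?thesis
      using that IV by (auto simp: stable_sets_def stable_def)
  qed
  have "coeff (expansion_whitney_poly V E X i) ?r = (\<Sum>Y\<in>?S. ?h Y)"
    using i by (simp add: coeff_expansion_whitney_poly[OF V])
  also have "\<dots> = (\<Sum>Y\<in>{Y \<in> Pow ?I. card Y \<le> i - ?r}. ?h Y)"
  proof (rule sum.mono_neutral_right)
    show "finite ?S"
      using finite_stable_sets[OF V, of E X] by simp
    show "{Y \<in> Pow ?I. card Y \<le> i - ?r} \<subseteq> ?S"
      using stab by blast
    show "\<forall>Y\<in>?S - {Y \<in> Pow ?I. card Y \<le> i - ?r}. ?h Y = 0"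
      using drop by (auto simp: stable_sets_def)
  qed
  also have "\<dots> = (\<Sum>Y\<in>{Y \<in> Pow ?I. card Y \<le> i - ?r}.
      graph_whitney V E ?r * ((- 1) ^ card Y * int ((c - card Y) choose ?m)))"
    using keep cn by (intro sum.cong) auto
  also have "\<dots> = (\<Sum>Y\<in>Pow ?I. graph_whitney V E ?r * ((- 1) ^ card Y * int ((c - card Y) choose ?m)))"
  proof (intro sum.mono_neutral_left ballI)
    fix Y assume Y: "Y \<in> Pow ?I - {Y \<in> Pow ?I. card Y \<le> i - ?r}"
    then have "card Y \<le> \<zeta>"
      unfolding \<zeta>_def using I by (intro card_mono) auto
    then have "c - card Y < ?m"
      using Y i m \<zeta>c cn by auto
    then show "graph_whitney V E ?r * ((- 1) ^ card Y * int ((c - card Y) choose ?m)) = 0"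
      by simp
  qed (use I in auto)
  also have "\<dots> = graph_whitney V E ?r * int ((c - \<zeta>) choose (?m - \<zeta>))"
    unfolding sum_distrib_left[symmetric] \<zeta>_def
    using alternating_subset_binomial_sum[OF I, of c ?m] m \<zeta>c by (simp add: \<zeta>_def)
  \<comment> \<open>The two lower indices add up to \<open>c - \<zeta>\<close>.\<close>
  also have "(c - \<zeta>) choose (?m - \<zeta>) = (c - \<zeta>) choose (i - ?r)"
    using binomial_symmetric[of "?m - \<zeta>" "c - \<zeta>"] m \<zeta>c cn i by (simp add: add.commute)
  finally show ?thesis .
qed

theorem theorem2:
  fixes V X :: "'v set" and E :: "'v set set" and ori :: "'v set \<Rightarrow> 'v \<times> 'v"
    and G :: "('g, 'b) monoid_scheme"
    and n c \<gamma> \<zeta> :: nat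
  assumes "simple_graph V E"
    and "n = card V" and "n > 0"
    and "c = card (graph_components V E)"
    and "orientation E ori"
    and "group G" and "finite (carrier G)" and "\<gamma> = Coset.order G"
    and "X \<subseteq> V"
    and "\<zeta> = card (isolated_vertices V E - X)"
  shows
    "(\<forall>i\<le>n - \<zeta>.
        gain_whitney G (expansion G V E ori X) i = poly (expansion_whitney_poly V E X i) (int \<gamma>) \<and>
        expansion_whitney_poly V E X i \<noteq> 0 \<and>
        degree (expansion_whitney_poly V E X i) = min i (n - c) \<and>
        gain_whitney G (expansion G V E ori X) i =
          (\<Sum>j=0..i. int \<gamma> ^ j *
            (\<Sum>k=0..i - j. (- 1) ^ k * int ((n - j - k) choose (n - i)) *
              (\<Sum>Y | Y \<subseteq> V - X \<and> stable E Y \<and> card Y = k.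
                 graph_whitney (V - Y) (delete_edges_at E Y) j))) \<and>
        (i \<le> n - c \<longrightarrow>
          lead_coeff (expansion_whitney_poly V E X i) = graph_whitney V E i) \<and>
        (n - c \<le> i \<longrightarrow>
          lead_coeff (expansion_whitney_poly V E X i) =
            graph_whitney V E (n - c) * int ((c - \<zeta>) choose (i - (n - c))))) \<and>
     (\<forall>i>n - \<zeta>. gain_whitney G (expansion G V E ori X) i = 0)"
proof (intro conjI[of "\<forall>i\<le>n - \<zeta>. _ i"] allI impI)
  fix i assume i: "i > n - \<zeta>"
  then show "gain_whitney G (expansion G V E ori X) i = 0"
    using gain_whitney_expansion_zero[OF assms(1,5)] assms(2,10) by blast
next
  fix i assume i: "i \<le> n - \<zeta>"
  let ?p = "expansion_whitney_poly V E X i"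
  note sg = assms(1)
  have formula: "gain_whitney G (expansion G V E ori X) i =
      (\<Sum>j=0..i. int \<gamma> ^ j *
        (\<Sum>k=0..i - j. (- 1) ^ k * int ((n - j - k) choose (n - i)) *
          (\<Sum>Y | Y \<subseteq> V - X \<and> stable E Y \<and> card Y = k.
             graph_whitney (V - Y) (delete_edges_at E Y) j)))"
    using gain_whitney_expansion[OF sg assms(5-7,9), of i] i unfolding assms(2,8) by simp
  have eval: "gain_whitney G (expansion G V E ori X) i = poly ?p (int \<gamma>)"
    unfolding formula by (simp add: expansion_whitney_poly_def poly_sum poly_monom assms(2) mult.commute)
  \<comment> \<open>Positivity at this one index gives both that the polynomial is nonzero and the
    lower bound on its degree.\<close>
  have lead: "coeff ?p (min i (n - c)) > 0"
    and diag: "i \<le> n - c \<Longrightarrow> coeff ?p (min i (n - c)) = graph_whitney V E i"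
    and rank: "n - c \<le> i \<Longrightarrow> coeff ?p (min i (n - c)) =
      graph_whitney V E (n - c) * int ((c - \<zeta>) choose (i - (n - c)))"
  proof -
    show diag: "coeff ?p (min i (n - c)) = graph_whitney V E i" if "i \<le> n - c"
      using coeff_expansion_whitney_poly_diagonal[OF sg, of X i] that by (simp add: min_absorb1)
    show rank: "coeff ?p (min i (n - c)) =
        graph_whitney V E (n - c) * int ((c - \<zeta>) choose (i - (n - c)))" if "n - c \<le> i"
      using coeff_expansion_whitney_poly_rank[OF sg, of i X] i that
      by (simp add: min_absorb2 assms(2,4,10))
    show "coeff ?p (min i (n - c)) > 0"
    proof (cases "i \<le> n - c")
      case True
      then show ?thesis
        using diag graph_whitney_pos[OF sg, of i] by (simp add: assms(2,4))
    next
      case False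
      have "c \<le> n"
        using graph_components_le[OF sg] by (simp add: assms(2,4))
      \<comment> \<open>The bound \<open>i \<le> n - \<zeta>\<close> is what keeps the binomial
        coefficient positive.\<close>
      then have "i - (n - c) \<le> c - \<zeta>"
        using i False by linarith
      then have "(c - \<zeta>) choose (i - (n - c)) > 0"
        by simp
      moreover have "graph_whitney V E (n - c) > 0"
        using graph_whitney_pos[OF sg, of "n - c"] by (simp add: assms(2,4))
      ultimately show ?thesis
        using rank False by simp
    qed
  qed
  have "degree ?p \<le> min i (n - c)"
  \<comment> \<open>Beyond \<open>i\<close> there are no terms; beyond \<open>n - c\<close> the
    index exceeds the rank of every deleted subgraph.\<close>
  proof (rule degree_le, intro allI impI)
    fix j assume "min i (n - c) < j"
    then show "coeff ?p j = 0"
      using coeff_expansion_whitney_poly_zero[OF sg, of j X i]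
        coeff_expansion_whitney_poly[OF simple_graphD(1)[OF sg], of E X i j]
      by (cases "j \<le> i") (simp_all add: assms(2,4))
  qed
  moreover have "min i (n - c) \<le> degree ?p"
    using lead by (intro le_degree) simp
  ultimately have deg: "degree ?p = min i (n - c)"
    by (rule antisym)
  have "?p \<noteq> 0"
    using lead by auto
  then show "gain_whitney G (expansion G V E ori X) i = poly ?p (int \<gamma>) \<and> ?p \<noteq> 0 \<and>
      degree ?p = min i (n - c) \<and>
      gain_whitney G (expansion G V E ori X) i =
        (\<Sum>j=0..i. int \<gamma> ^ j *
          (\<Sum>k=0..i - j. (- 1) ^ k * int ((n - j - k) choose (n - i)) *
            (\<Sum>Y | Y \<subseteq> V - X \<and> stable E Y \<and> card Y = k.
               graph_whitney (V - Y) (delete_edges_at E Y) j))) \<and>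
      (i \<le> n - c \<longrightarrow> lead_coeff ?p = graph_whitney V E i) \<and>
      (n - c \<le> i \<longrightarrow> lead_coeff ?p =
        graph_whitney V E (n - c) * int ((c - \<zeta>) choose (i - (n - c))))"
    using eval deg formula diag rank by (intro conjI impI) simp_all
qed

end
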